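(* Let $\mathcal{A}$ be an abelian category. (1) Assume that $\mathcal{A}$ has enough injectives. Let $\mathcal{C}$ be a class of objects of $\mathcal{A}$ which is closed under binary direct sums and contains all injective objects of $\mathcal{A}$. Then the following are equivalent: (i) Every object of $\mathcal{C}$ is extending. (ii) Every object of $\mathcal{C}$ is self-CS-Rickart. (iii) Every object of $\mathcal{C}$ has SIP-extending. (2) Assume that $\mathcal{A}$ has enough projectives. Let $\mathcal{C}$ be a class of objects of $\mathcal{A}$ which is closed under binary direct sums and contains all projective objects of $\mathcal{A}$. Then the following are equivalent: (i) Every object of $\mathcal{C}$ is lifting. (ii) Every object of $\mathcal{C}$ is dual self-CS-Rickart. (iii) Every object of $\mathcal{C}$ has SSP-lifting.
   Context: A subobject $K$ of $L$ is essential in $L$ if $K\cap X=0$ implies $X=0$ for every subobject $X$ of $L$; $K$ is superfluous in $L$ if $K+X=L$ implies $X=L$ for every subobject $X$ of $L$. A subobject $L$ of $M$ lies above a direct summand of $M$ if $L$ contains a direct summand $K$ of $M$ such that $L/K$ is superfluous in $M/K$. An object $M$ of an abelian category is: extending if every subobject of $M$ is essential in a direct summand of $M$; lifting if every subobject of $M$ lies above a direct summand of $M$; self-CS-Rickart if for every morphism $f:M\to M$, $\mathrm{Ker}(f)$ is essential in a direct summand of $M$; dual self-CS-Rickart if for every morphism $f:M\to M$, $\mathrm{Im}(f)$ lies above a direct summand of $M$. $M$ has SIP-extending if for any two subobjects of $M$ which are essential in direct summands of $M$, their intersection is essential in a direct summand of $M$. $M$ has SSP-lifting if for any two subobjects of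 $M$ which lie above direct summands of $M$, their sum lies above a direct summand of $M$. *)

theory Defs
  imports "HOL-Algebra.Group" "HOL-Algebra.Lattice"
begin

section \<open>Abelian categories\<close>

text \<open>Composition is written in the usual order: in \<open>g \<cdot> f\<close>, \<open>f\<close> comes first. Composition and
  addition are only meaningful on composable and on parallel morphisms, respectively.\<close>

record ('o, 'm) cat_struct =
  Obj :: "'o set"
  Mor :: "'m set"
  Dom :: "'m \<Rightarrow> 'o"
  Cod :: "'m \<Rightarrow> 'o"
  Ide :: "'o \<Rightarrow> 'm"
  cmp :: "'m \<Rightarrow> 'm \<Rightarrow> 'm"  (infixl \<open>\<cdot>\<index>\<close> 75)
  add_mor :: "'m \<Rightarrow> 'm \<Rightarrow> 'm"  (infixl \<open>+\<index>\<close> 65)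
  zero_mor :: "'o \<Rightarrow> 'o \<Rightarrow> 'm"

definition Hom :: "('o, 'm) cat_struct \<Rightarrow> 'o \<Rightarrow> 'o \<Rightarrow> 'm set" where
  "Hom A X Y = {f \<in> Mor A. Dom A f = X \<and> Cod A f = Y}"

definition Hom_group :: "('o, 'm) cat_struct \<Rightarrow> 'o \<Rightarrow> 'o \<Rightarrow> 'm monoid" where
  "Hom_group A X Y = \<lparr>carrier = Hom A X Y, mult = add_mor A, one = zero_mor A X Y\<rparr>"

locale category =
  fixes A :: "('o, 'm) cat_struct" (structure)
  assumes Dom_in_Obj: "f \<in> Mor A \<Longrightarrow> Dom A f \<in> Obj A"
    and Cod_in_Obj: "f \<in> Mor A \<Longrightarrow> Cod A f \<in> Obj A"
    and Ide_in_Hom: "X \<in> Obj A \<Longrightarrow> Ide A X \<in> Hom A X X"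
    and cmp_in_Hom: "\<lbrakk>f \<in> Hom A X Y; g \<in> Hom A Y Z\<rbrakk> \<Longrightarrow> g \<cdot> f \<in> Hom A X Z"
    and cmp_assoc: "\<lbrakk>f \<in> Hom A X Y; g \<in> Hom A Y Z; h \<in> Hom A Z W\<rbrakk>
      \<Longrightarrow> (h \<cdot> g) \<cdot> f = h \<cdot> (g \<cdot> f)"
    and cmp_Ide_right: "f \<in> Hom A X Y \<Longrightarrow> f \<cdot> Ide A X = f"
    and cmp_Ide_left: "f \<in> Hom A X Y \<Longrightarrow> Ide A Y \<cdot> f = f"

locale preadditive_category = category +
  assumes Hom_comm_group: "\<lbrakk>X \<in> Obj A; Y \<in> Obj A\<rbrakk> \<Longrightarrow> comm_group (Hom_group A X Y)"
    and cmp_add_right: "\<lbrakk>f \<in> Hom A X Y; f' \<in> Hom A X Y; g \<in> Hom A Y Z\<rbrakk>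
      \<Longrightarrow> g \<cdot> (f +\<^bsub>A\<^esub> f') = g \<cdot> f +\<^bsub>A\<^esub> g \<cdot> f'"
    and cmp_add_left: "\<lbrakk>f \<in> Hom A X Y; g \<in> Hom A Y Z; g' \<in> Hom A Y Z\<rbrakk>
      \<Longrightarrow> (g +\<^bsub>A\<^esub> g') \<cdot> f = g \<cdot> f +\<^bsub>A\<^esub> g' \<cdot> f"

definition zero_object :: "('o, 'm) cat_struct \<Rightarrow> 'o \<Rightarrow> bool" where
  "zero_object A Z \<longleftrightarrow> Z \<in> Obj A
     \<and> (\<forall>X\<in>Obj A. (\<exists>!f. f \<in> Hom A X Z) \<and> (\<exists>!f. f \<in> Hom A Z X))"

definition is_mono :: "('o, 'm) cat_struct \<Rightarrow> 'm \<Rightarrow> bool" where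
  "is_mono A m \<longleftrightarrow> m \<in> Mor A \<and>
     (\<forall>X. \<forall>f\<in>Hom A X (Dom A m). \<forall>g\<in>Hom A X (Dom A m).
        m \<cdot>\<^bsub>A\<^esub> f = m \<cdot>\<^bsub>A\<^esub> g \<longrightarrow> f = g)"

definition is_epi :: "('o, 'm) cat_struct \<Rightarrow> 'm \<Rightarrow> bool" where
  "is_epi A e \<longleftrightarrow> e \<in> Mor A \<and>
     (\<forall>Y. \<forall>f\<in>Hom A (Cod A e) Y. \<forall>g\<in>Hom A (Cod A e) Y.
        f \<cdot>\<^bsub>A\<^esub> e = g \<cdot>\<^bsub>A\<^esub> e \<longrightarrow> f = g)"

definition is_kernel :: "('o, 'm) cat_struct \<Rightarrow> 'm \<Rightarrow> 'm \<Rightarrow> bool" where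
  "is_kernel A f k \<longleftrightarrow> k \<in> Mor A \<and> Cod A k = Dom A f
     \<and> f \<cdot>\<^bsub>A\<^esub> k = zero_mor A (Dom A k) (Cod A f)
     \<and> (\<forall>X. \<forall>g\<in>Hom A X (Dom A f). f \<cdot>\<^bsub>A\<^esub> g = zero_mor A X (Cod A f)
          \<longrightarrow> (\<exists>!u. u \<in> Hom A X (Dom A k) \<and> k \<cdot>\<^bsub>A\<^esub> u = g))"

definition is_cokernel :: "('o, 'm) cat_struct \<Rightarrow> 'm \<Rightarrow> 'm \<Rightarrow> bool" where
  "is_cokernel A f c \<longleftrightarrow> c \<in> Mor A \<and> Dom A c = Cod A f
     \<and> c \<cdot>\<^bsub>A\<^esub> f = zero_mor A (Dom A f) (Cod A c)
     \<and> (\<forall>Y. \<forall>g\<in>Hom A (Cod A f) Y. g \<cdot>\<^bsub>A\<^esub> f = zero_mor A (Dom A f) Y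
          \<longrightarrow> (\<exists>!u. u \<in> Hom A (Cod A c) Y \<and> u \<cdot>\<^bsub>A\<^esub> c = g))"

definition is_direct_sum ::
  "('o, 'm) cat_struct \<Rightarrow> 'o \<Rightarrow> 'o \<Rightarrow> 'o \<Rightarrow> 'm \<Rightarrow> 'm \<Rightarrow> 'm \<Rightarrow> 'm \<Rightarrow> bool" where
  "is_direct_sum A X Y S i j p q \<longleftrightarrow>
     i \<in> Hom A X S \<and> j \<in> Hom A Y S \<and> p \<in> Hom A S X \<and> q \<in> Hom A S Y
     \<and> p \<cdot>\<^bsub>A\<^esub> i = Ide A X \<and> q \<cdot>\<^bsub>A\<^esub> j = Ide A Y
     \<and> p \<cdot>\<^bsub>A\<^esub> j = zero_mor A Y X \<and> q \<cdot>\<^bsub>A\<^esub> i = zero_mor A X Y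
     \<and> i \<cdot>\<^bsub>A\<^esub> p +\<^bsub>A\<^esub> j \<cdot>\<^bsub>A\<^esub> q = Ide A S"

locale abelian_category = preadditive_category +
  assumes zero_object_exists: "\<exists>Z. zero_object A Z"
    and direct_sum_exists:
      "\<lbrakk>X \<in> Obj A; Y \<in> Obj A\<rbrakk> \<Longrightarrow> \<exists>S i j p q. is_direct_sum A X Y S i j p q"
    and kernel_exists: "f \<in> Mor A \<Longrightarrow> \<exists>k. is_kernel A f k"
    and cokernel_exists: "f \<in> Mor A \<Longrightarrow> \<exists>c. is_cokernel A f c"
    and mono_normal: "is_mono A m \<Longrightarrow> \<exists>f\<in>Mor A. is_kernel A f m"
    and epi_normal: "is_epi A e \<Longrightarrow> \<exists>f\<in>Mor A. is_cokernel A f e"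

text \<open>Kernels and cokernels are unique only up to isomorphism; the following pick one.
  All notions below are invariant under that choice.\<close>

definition Ker :: "('o, 'm) cat_struct \<Rightarrow> 'm \<Rightarrow> 'm" where
  "Ker A f = (SOME k. is_kernel A f k)"

definition Coker :: "('o, 'm) cat_struct \<Rightarrow> 'm \<Rightarrow> 'm" where
  "Coker A f = (SOME c. is_cokernel A f c)"

definition Img :: "('o, 'm) cat_struct \<Rightarrow> 'm \<Rightarrow> 'm" where
  "Img A f = Ker A (Coker A f)"

definition injective_object :: "('o, 'm) cat_struct \<Rightarrow> 'o \<Rightarrow> bool" where
  "injective_object A E \<longleftrightarrow> E \<in> Obj A \<and>
     (\<forall>m. is_mono A m \<longrightarrow>
        (\<forall>f\<in>Hom A (Dom A m) E. \<exists>g\<in>Hom A (Cod A m) E. g \<cdot>\<^bsub>A\<^esub> m = f))"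

definition projective_object :: "('o, 'm) cat_struct \<Rightarrow> 'o \<Rightarrow> bool" where
  "projective_object A P \<longleftrightarrow> P \<in> Obj A \<and>
     (\<forall>e. is_epi A e \<longrightarrow>
        (\<forall>f\<in>Hom A P (Cod A e). \<exists>g\<in>Hom A P (Dom A e). e \<cdot>\<^bsub>A\<^esub> g = f))"

definition enough_injectives :: "('o, 'm) cat_struct \<Rightarrow> bool" where
  "enough_injectives A \<longleftrightarrow>
     (\<forall>X\<in>Obj A. \<exists>E m. injective_object A E \<and> m \<in> Hom A X E \<and> is_mono A m)"

definition enough_projectives :: "('o, 'm) cat_struct \<Rightarrow> bool" where
  "enough_projectives A \<longleftrightarrow>
     (\<forall>X\<in>Obj A. \<exists>P e. projective_object A P \<and> e \<in> Hom A P X \<and> is_epi A e)"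

text \<open>Only some direct sum of \<open>X\<close> and \<open>Y\<close> has to lie in the class, so that the class
  need not be closed under isomorphism.\<close>

definition closed_under_direct_sums :: "('o, 'm) cat_struct \<Rightarrow> 'o set \<Rightarrow> bool" where
  "closed_under_direct_sums A \<C> \<longleftrightarrow>
     (\<forall>X\<in>\<C>. \<forall>Y\<in>\<C>. \<exists>S\<in>\<C>. \<exists>i j p q. is_direct_sum A X Y S i j p q)"


section \<open>Subobjects\<close>

text \<open>A subobject of \<open>M\<close> is represented by a monomorphism into \<open>M\<close>. Two monomorphisms
  represent the same subobject iff each factors through the other, which is the equality
  \<open>.=\<close> of the order \<^term>\<open>Sub A M\<close>. Intersections and sums of subobjects are the lattice
  operations \<open>\<sqinter>\<close> and \<open>\<squnion>\<close> of this order.\<close>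

definition factors_through :: "('o, 'm) cat_struct \<Rightarrow> 'm \<Rightarrow> 'm \<Rightarrow> bool" where
  "factors_through A k l \<longleftrightarrow> (\<exists>h\<in>Hom A (Dom A k) (Dom A l). k = l \<cdot>\<^bsub>A\<^esub> h)"

definition Sub :: "('o, 'm) cat_struct \<Rightarrow> 'o \<Rightarrow> 'm gorder" where
  "Sub A M = \<lparr>carrier = {k. is_mono A k \<and> Cod A k = M},
     eq = (\<lambda>k l. factors_through A k l \<and> factors_through A l k),
     le = factors_through A\<rparr>"

definition essential :: "('o, 'm) cat_struct \<Rightarrow> 'o \<Rightarrow> 'm \<Rightarrow> bool" where
  "essential A L k \<longleftrightarrow> k \<in> carrier (Sub A L) \<and>
     (\<forall>x\<in>carrier (Sub A L).
        zero_object A (Dom A (k \<sqinter>\<^bsub>Sub A L\<^esub> x)) \<longrightarrow> zero_object A (Dom A x))"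

definition superfluous :: "('o, 'm) cat_struct \<Rightarrow> 'o \<Rightarrow> 'm \<Rightarrow> bool" where
  "superfluous A L k \<longleftrightarrow> k \<in> carrier (Sub A L) \<and>
     (\<forall>x\<in>carrier (Sub A L).
        (k \<squnion>\<^bsub>Sub A L\<^esub> x) .=\<^bsub>Sub A L\<^esub> Ide A L \<longrightarrow> x .=\<^bsub>Sub A L\<^esub> Ide A L)"

definition direct_summand :: "('o, 'm) cat_struct \<Rightarrow> 'o \<Rightarrow> 'm \<Rightarrow> bool" where
  "direct_summand A M d \<longleftrightarrow> d \<in> carrier (Sub A M) \<and>
     (\<exists>Y j p q. is_direct_sum A (Dom A d) Y M d j p q)"

text \<open>If \<open>k\<close> is contained in \<open>d\<close>, then \<open>k\<close> regarded as a subobject of \<^term>\<open>Dom A d\<close> is the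
  morphism \<open>h\<close> with \<open>k = d \<cdot> h\<close>.\<close>

definition essential_in_summand :: "('o, 'm) cat_struct \<Rightarrow> 'o \<Rightarrow> 'm \<Rightarrow> bool" where
  "essential_in_summand A M k \<longleftrightarrow> k \<in> carrier (Sub A M) \<and>
     (\<exists>d h. direct_summand A M d \<and> h \<in> Hom A (Dom A k) (Dom A d) \<and> k = d \<cdot>\<^bsub>A\<^esub> h
        \<and> essential A (Dom A d) h)"

text \<open>For a direct summand \<open>d = l \<cdot> h\<close> contained in \<open>l\<close>, the quotient of \<open>M\<close> by \<open>d\<close> is the
  codomain of \<^term>\<open>Coker A d\<close>, and the quotient of \<open>l\<close> by \<open>d\<close>, as a subobject of it, is the
  morphism \<open>j\<close> induced by \<open>l\<close> on the codomain of \<^term>\<open>Coker A h\<close>.\<close>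

definition lies_above_summand :: "('o, 'm) cat_struct \<Rightarrow> 'o \<Rightarrow> 'm \<Rightarrow> bool" where
  "lies_above_summand A M l \<longleftrightarrow> l \<in> carrier (Sub A M) \<and>
     (\<exists>d h j. direct_summand A M d \<and> h \<in> Hom A (Dom A d) (Dom A l) \<and> d = l \<cdot>\<^bsub>A\<^esub> h
        \<and> j \<in> Hom A (Cod A (Coker A h)) (Cod A (Coker A d))
        \<and> j \<cdot>\<^bsub>A\<^esub> Coker A h = Coker A d \<cdot>\<^bsub>A\<^esub> l
        \<and> superfluous A (Cod A (Coker A d)) j)"


section \<open>Properties of objects\<close>

definition extending :: "('o, 'm) cat_struct \<Rightarrow> 'o \<Rightarrow> bool" where
  "extending A M \<longleftrightarrow> (\<forall>k\<in>carrier (Sub A M). essential_in_summand A M k)"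

definition lifting :: "('o, 'm) cat_struct \<Rightarrow> 'o \<Rightarrow> bool" where
  "lifting A M \<longleftrightarrow> (\<forall>l\<in>carrier (Sub A M). lies_above_summand A M l)"

definition self_CS_Rickart :: "('o, 'm) cat_struct \<Rightarrow> 'o \<Rightarrow> bool" where
  "self_CS_Rickart A M \<longleftrightarrow> (\<forall>f\<in>Hom A M M. essential_in_summand A M (Ker A f))"

definition dual_self_CS_Rickart :: "('o, 'm) cat_struct \<Rightarrow> 'o \<Rightarrow> bool" where
  "dual_self_CS_Rickart A M \<longleftrightarrow> (\<forall>f\<in>Hom A M M. lies_above_summand A M (Img A f))"

definition SIP_extending :: "('o, 'm) cat_struct \<Rightarrow> 'o \<Rightarrow> bool" where
  "SIP_extending A M \<longleftrightarrow>
     (\<forall>k\<in>carrier (Sub A M). \<forall>l\<in>carrier (Sub A M).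
        essential_in_summand A M k \<and> essential_in_summand A M l
        \<longrightarrow> essential_in_summand A M (k \<sqinter>\<^bsub>Sub A M\<^esub> l))"

definition SSP_lifting :: "('o, 'm) cat_struct \<Rightarrow> 'o \<Rightarrow> bool" where
  "SSP_lifting A M \<longleftrightarrow>
     (\<forall>k\<in>carrier (Sub A M). \<forall>l\<in>carrier (Sub A M).
        lies_above_summand A M k \<and> lies_above_summand A M l
        \<longrightarrow> lies_above_summand A M (k \<squnion>\<^bsub>Sub A M\<^esub> l))"

end

theory Submission
  imports Defs
begin

text \<open>
  In part (1), extending trivially implies the other two properties: kernels of endomorphisms and
  intersections are subobjects like any others. Conversely, let \<open>k: K \<rightarrow> M\<close> be a subobject
  of an object of the class. Composing the quotient map \<open>M \<rightarrow> M/K\<close> with an embedding of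
  \<open>M/K\<close> into an injective object \<open>E\<close> gives \<open>f: M \<rightarrow> E\<close> with kernel \<open>K\<close>, and \<open>S = M \<oplus> E\<close> (with
  injections \<open>i\<close>, \<open>j\<close> and projections \<open>p\<close>, \<open>q\<close>) can be taken in the class.

  If \<open>S\<close> is self-CS-Rickart, apply this to the endomorphism \<open>j f p\<close>, whose kernel is \<open>K \<oplus> E\<close>. If
  \<open>e\<close> is an idempotent whose image contains \<open>K \<oplus> E\<close> as an essential subobject, then \<open>e j = j\<close>, which
  makes \<open>p e i\<close> an idempotent of \<open>M\<close>; \<open>K\<close> is essential in its image
  (\<open>essential_split_if_kernel\<close>).

  If \<open>S\<close> has SIP-extending, apply this to \<open>M\<close> and to the graph of \<open>f\<close>. Both are direct summands and
  their intersection is \<open>K\<close>, so \<open>K\<close> is essential in a summand \<open>d: D \<rightarrow> S\<close>, with retraction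
  \<open>\<pi>: S \<rightarrow> D\<close>. The projection \<open>p d: D \<rightarrow> M\<close> splits: with
  \<open>g = q d: D \<rightarrow> E\<close> and \<open>h = \<pi> j: E \<rightarrow> D\<close> one has \<open>\<pi> i p d = 1 - h g\<close>, where \<open>g\<close> kills \<open>K\<close>.
  Essentiality of \<open>K\<close> makes \<open>1 - g h: E \<rightarrow> E\<close> a monomorphism, so it has a left inverse \<open>r\<close> because
  \<open>E\<close> is injective, and \<open>1 + h r g\<close> is a left inverse of \<open>1 - h g\<close>. Hence \<open>D\<close> is also a summand of
  \<open>M\<close>, and it still contains \<open>K\<close> as an essential subobject (\<open>essential_split_if_meet\<close>).

  Part (2) is part (1) in the opposite category. To make the two sides match, being essential in a
  direct summand is expressed by the predicate \<open>essential_split\<close>, which speaks only of an idempotent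
  and of factorisations. A subobject lies above a direct summand exactly if its cokernel satisfies
  this predicate in the opposite category (\<open>lies_above_summand_iff\<close>), and the cokernel of a sum of
  subobjects is the intersection of their cokernels there (\<open>Coker_join\<close>).
\<close>

section \<open>Composition and addition of morphisms\<close>

lemma Hom_iff: "f \<in> Hom A X Y \<longleftrightarrow> f \<in> Mor A \<and> Dom A f = X \<and> Cod A f = Y"
  by (simp add: Hom_def)

context category
begin

lemmas Dom_Cod_in_Obj [simp] = Dom_in_Obj Cod_in_Obj

lemma Ide_simps [simp]:
  assumes "X \<in> Obj A"
  shows "Ide A X \<in> Mor A" "Dom A (Ide A X) = X" "Cod A (Ide A X) = X"
  using Ide_in_Hom[OF assms] by (auto simp: Hom_iff)

lemma cmp_simps [simp]:
  assumes "f \<in> Mor A" "g \<in> Mor A" "Cod A f = Dom A g"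
  shows "g \<cdot> f \<in> Mor A" "Dom A (g \<cdot> f) = Dom A f" "Cod A (g \<cdot> f) = Cod A g"
  using cmp_in_Hom[of f "Dom A f" "Cod A f" g "Cod A g"] assms by (auto simp: Hom_iff)

lemma assoc [simp]:
  assumes "f \<in> Mor A" "g \<in> Mor A" "h \<in> Mor A" "Cod A f = Dom A g" "Cod A g = Dom A h"
  shows "(h \<cdot> g) \<cdot> f = h \<cdot> (g \<cdot> f)"
  using assms cmp_assoc[of f "Dom A f" "Cod A f" g "Cod A g" h "Cod A h"]
  by (simp add: Hom_iff)

lemma Ide_neutral [simp]:
  "f \<in> Mor A \<Longrightarrow> Cod A f = Y \<Longrightarrow> Ide A Y \<cdot> f = f"
  "f \<in> Mor A \<Longrightarrow> Dom A f = X \<Longrightarrow> f \<cdot> Ide A X = f"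
  using cmp_Ide_left[of f "Dom A f" "Cod A f"] cmp_Ide_right[of f "Dom A f" "Cod A f"]
  by (auto simp: Hom_iff)

text \<open>Since the simplifier brackets compositions to the right, an equation \<open>g \<cdot> f = h\<close> is also
  needed with a further morphism to the right of \<open>f\<close>.\<close>

lemma cmp_extend:
  assumes "g \<cdot> f = h" "f \<in> Mor A" "g \<in> Mor A" "Cod A f = Dom A g" "t \<in> Mor A" "Cod A t = Dom A f"
  shows "g \<cdot> (f \<cdot> t) = h \<cdot> t"
  using assms assoc[of t f g] by simp

lemma mono_Mor: "is_mono A m \<Longrightarrow> m \<in> Mor A"
  by (simp add: is_mono_def)

lemma mono_cancel:
  assumes "is_mono A m" "f \<in> Mor A" "g \<in> Mor A" "Cod A f = Dom A m" "Cod A g = Dom A m"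
    "m \<cdot> f = m \<cdot> g"
  shows "f = g"
proof -
  have m: "m \<in> Mor A" using assms(1) by (rule mono_Mor)
  have "Dom A f = Dom A (m \<cdot> f)" using m assms(2,4) by simp
  also have "\<dots> = Dom A g" unfolding assms(6) using m assms(3,5) by simp
  finally have "Dom A f = Dom A g" .
  hence "f \<in> Hom A (Dom A g) (Dom A m)" "g \<in> Hom A (Dom A g) (Dom A m)"
    using assms by (simp_all add: Hom_iff)
  thus ?thesis using assms(1,6) unfolding is_mono_def by blast
qed

lemma epi_Mor: "is_epi A m \<Longrightarrow> m \<in> Mor A"
  by (simp add: is_epi_def)

lemma epi_cancel:
  assumes "is_epi A m" "f \<in> Mor A" "g \<in> Mor A" "Dom A f = Cod A m" "Dom A g = Cod A m"
    "f \<cdot> m = g \<cdot> m"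
  shows "f = g"
proof -
  have m: "m \<in> Mor A" using assms(1) by (rule epi_Mor)
  have "Cod A f = Cod A (f \<cdot> m)" using m assms(2,4) by simp
  also have "\<dots> = Cod A g" unfolding assms(6) using m assms(3,5) by simp
  finally have "Cod A f = Cod A g" .
  hence "f \<in> Hom A (Cod A m) (Cod A g)" "g \<in> Hom A (Cod A m) (Cod A g)"
    using assms by (simp_all add: Hom_iff)
  thus ?thesis using assms(1,6) unfolding is_epi_def by blast
qed

lemma mono_cmp:
  assumes "is_mono A f" "is_mono A g" "Cod A f = Dom A g"
  shows "is_mono A (g \<cdot> f)"
proof -
  have m: "f \<in> Mor A" "g \<in> Mor A" using assms by (auto intro: mono_Mor)
  show ?thesis
    unfolding is_mono_def
  proof (intro conjI allI ballI impI)
    show "g \<cdot> f \<in> Mor A" using m assms by simp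
    fix X a b assume a: "a \<in> Hom A X (Dom A (g \<cdot> f))" "b \<in> Hom A X (Dom A (g \<cdot> f))"
      "(g \<cdot> f) \<cdot> a = (g \<cdot> f) \<cdot> b"
    hence ab: "a \<in> Mor A" "b \<in> Mor A" "Cod A a = Dom A f" "Cod A b = Dom A f"
      using m assms(3) by (auto simp: Hom_iff)
    have "g \<cdot> (f \<cdot> a) = g \<cdot> (f \<cdot> b)" using a(3) m assms(3) ab by simp
    hence "f \<cdot> a = f \<cdot> b" using mono_cancel[OF assms(2), of "f \<cdot> a" "f \<cdot> b"] m assms(3) ab by simp
    thus "a = b" using mono_cancel[OF assms(1) ab(1,2)] ab by simp
  qed
qed

lemma mono_cmpD:
  assumes "is_mono A (g \<cdot> f)" "f \<in> Mor A" "g \<in> Mor A" "Cod A f = Dom A g"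
  shows "is_mono A f"
  unfolding is_mono_def
proof (intro conjI allI ballI impI)
  show "f \<in> Mor A" by fact
  fix X a b assume a: "a \<in> Hom A X (Dom A f)" "b \<in> Hom A X (Dom A f)" "f \<cdot> a = f \<cdot> b"
  hence ab: "a \<in> Mor A" "b \<in> Mor A" "Cod A a = Dom A f" "Cod A b = Dom A f"
    by (auto simp: Hom_iff)
  have "(g \<cdot> f) \<cdot> a = (g \<cdot> f) \<cdot> b" using assms(2-4) ab by (simp add: a(3))
  thus "a = b" using mono_cancel[OF assms(1) ab(1,2)] ab assms(2-4) by simp
qed

lemma mono_Ide: "X \<in> Obj A \<Longrightarrow> is_mono A (Ide A X)"
  by (auto simp: is_mono_def Hom_iff)

lemma split_mono:
  assumes "r \<cdot> d = Ide A (Dom A d)" "d \<in> Mor A" "r \<in> Mor A" "Cod A d = Dom A r"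
  shows "is_mono A d"
  by (rule mono_cmpD[of r]) (use assms mono_Ide in auto)

lemma epi_cmp:
  assumes "is_epi A f" "is_epi A g" "Cod A f = Dom A g"
  shows "is_epi A (g \<cdot> f)"
proof -
  have m: "f \<in> Mor A" "g \<in> Mor A" using assms by (auto intro: epi_Mor)
  show ?thesis
    unfolding is_epi_def
  proof (intro conjI allI ballI impI)
    show "g \<cdot> f \<in> Mor A" using m assms by simp
    fix X a b assume a: "a \<in> Hom A (Cod A (g \<cdot> f)) X" "b \<in> Hom A (Cod A (g \<cdot> f)) X"
      "a \<cdot> (g \<cdot> f) = b \<cdot> (g \<cdot> f)"
    hence ab: "a \<in> Mor A" "b \<in> Mor A" "Dom A a = Cod A g" "Dom A b = Cod A g"
      using m assms(3) by (auto simp: Hom_iff)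
    have "(a \<cdot> g) \<cdot> f = (b \<cdot> g) \<cdot> f" using a(3) m assms(3) ab by simp
    hence "a \<cdot> g = b \<cdot> g" using epi_cancel[OF assms(1), of "a \<cdot> g" "b \<cdot> g"] m assms(3) ab by simp
    thus "a = b" using epi_cancel[OF assms(2) ab(1,2)] ab by simp
  qed
qed

lemma factors_throughI:
  assumes "l \<cdot> h = k" "h \<in> Mor A" "l \<in> Mor A" "Cod A h = Dom A l"
  shows "factors_through A k l"
proof -
  have "Dom A k = Dom A h" unfolding assms(1)[symmetric] using assms(2-4) by simp
  hence "h \<in> Hom A (Dom A k) (Dom A l)" using assms(2,4) by (simp add: Hom_iff)
  thus ?thesis unfolding factors_through_def using assms(1) by blast
qed

lemma factors_throughE:
  assumes "factors_through A k l"
  obtains h where "h \<in> Mor A" "Dom A h = Dom A k" "Cod A h = Dom A l" "l \<cdot> h = k"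
proof -
  obtain h where "h \<in> Hom A (Dom A k) (Dom A l)" "k = l \<cdot> h"
    using assms unfolding factors_through_def by blast
  thus ?thesis by (intro that[of h]) (simp_all add: Hom_iff)
qed

lemma factors_through_refl: "k \<in> Mor A \<Longrightarrow> factors_through A k k"
  by (rule factors_throughI[of _ "Ide A (Dom A k)"]) simp_all

lemma factors_through_trans:
  assumes "factors_through A k l" "factors_through A l m" "m \<in> Mor A"
  shows "factors_through A k m"
proof -
  obtain a where a: "a \<in> Mor A" "Dom A a = Dom A k" "Cod A a = Dom A l" "l \<cdot> a = k"
    using assms(1) by (rule factors_throughE)
  obtain b where b: "b \<in> Mor A" "Dom A b = Dom A l" "Cod A b = Dom A m" "m \<cdot> b = l"
    using assms(2) by (rule factors_throughE)
  have "m \<cdot> (b \<cdot> a) = k" using cmp_extend[OF b(4)] a b assms(3) by simp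
  thus ?thesis by (rule factors_throughI) (use a b assms in simp_all)
qed

end

context preadditive_category
begin

abbreviation zero where "zero \<equiv> zero_mor A"

lemma zero_simps [simp]:
  assumes "X \<in> Obj A" "Y \<in> Obj A"
  shows "zero X Y \<in> Mor A" "Dom A (zero X Y) = X" "Cod A (zero X Y) = Y"
proof -
  interpret comm_group "Hom_group A X Y" using assms by (rule Hom_comm_group)
  show "zero X Y \<in> Mor A" "Dom A (zero X Y) = X" "Cod A (zero X Y) = Y"
    using one_closed by (auto simp: Hom_group_def Hom_iff)
qed

lemma add_simps [simp]:
  assumes "f \<in> Mor A" "g \<in> Mor A" "Dom A f = Dom A g" "Cod A f = Cod A g"
  shows "f +\<^bsub>A\<^esub> g \<in> Mor A" "Dom A (f +\<^bsub>A\<^esub> g) = Dom A g" "Cod A (f +\<^bsub>A\<^esub> g) = Cod A g"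
proof -
  interpret comm_group "Hom_group A (Dom A f) (Cod A f)" by (rule Hom_comm_group) (use assms in auto)
  show "f +\<^bsub>A\<^esub> g \<in> Mor A" "Dom A (f +\<^bsub>A\<^esub> g) = Dom A g" "Cod A (f +\<^bsub>A\<^esub> g) = Cod A g"
    using m_closed[of f g] assms by (auto simp: Hom_group_def Hom_iff)
qed

lemma add_zero [simp]:
  assumes "f \<in> Mor A" "Dom A f = X" "Cod A f = Y"
  shows "f +\<^bsub>A\<^esub> zero X Y = f" "zero X Y +\<^bsub>A\<^esub> f = f"
proof -
  interpret comm_group "Hom_group A X Y" by (rule Hom_comm_group) (use assms in auto)
  show "f +\<^bsub>A\<^esub> zero X Y = f" "zero X Y +\<^bsub>A\<^esub> f = f"
    using r_one[of f] l_one[of f] assms by (auto simp: Hom_group_def Hom_iff)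
qed

lemma add_comm:
  assumes "f \<in> Mor A" "g \<in> Mor A" "Dom A f = Dom A g" "Cod A f = Cod A g"
  shows "f +\<^bsub>A\<^esub> g = g +\<^bsub>A\<^esub> f"
proof -
  interpret comm_group "Hom_group A (Dom A f) (Cod A f)" by (rule Hom_comm_group) (use assms in auto)
  show ?thesis using m_comm[of f g] assms by (auto simp: Hom_group_def Hom_iff)
qed

lemma add_cancel:
  assumes "f +\<^bsub>A\<^esub> g = f +\<^bsub>A\<^esub> h" "f \<in> Mor A" "g \<in> Mor A" "h \<in> Mor A"
    "Dom A g = Dom A f" "Cod A g = Cod A f" "Dom A h = Dom A f" "Cod A h = Cod A f"
  shows "g = h"
proof -
  interpret comm_group "Hom_group A (Dom A f) (Cod A f)" by (rule Hom_comm_group) (use assms in auto)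
  have "f \<in> Units (Hom_group A (Dom A f) (Cod A f))"
    using assms Units_eq by (simp add: Hom_group_def Hom_iff)
  from Units_l_cancel[OF this, of g h] show ?thesis
    using assms by (simp add: Hom_group_def Hom_iff)
qed

text \<open>Negatives are needed only in this form, for example as the complement \<open>1 - e\<close> of an
  endomorphism \<open>e\<close>.\<close>

lemma complement_exists:
  assumes "f \<in> Mor A" "g \<in> Mor A" "Dom A f = Dom A g" "Cod A f = Cod A g"
  obtains h where "h \<in> Mor A" "Dom A h = Dom A g" "Cod A h = Cod A g" "f +\<^bsub>A\<^esub> h = g"
proof -
  interpret comm_group "Hom_group A (Dom A f) (Cod A f)" by (rule Hom_comm_group) (use assms in auto)
  let ?n = "inv\<^bsub>Hom_group A (Dom A f) (Cod A f)\<^esub> f"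
  have f: "f \<in> carrier (Hom_group A (Dom A f) (Cod A f))"
    and g: "g \<in> carrier (Hom_group A (Dom A f) (Cod A f))"
    using assms by (auto simp: Hom_group_def Hom_iff)
  let ?h = "?n \<otimes>\<^bsub>Hom_group A (Dom A f) (Cod A f)\<^esub> g"
  have "?h \<in> carrier (Hom_group A (Dom A f) (Cod A f))" using f g by simp
  moreover have "f \<otimes>\<^bsub>Hom_group A (Dom A f) (Cod A f)\<^esub> ?h = g"
    using f g by (simp flip: m_assoc)
  ultimately show ?thesis using assms by (intro that[of ?h]) (auto simp: Hom_group_def Hom_iff)
qed

lemma distrib [simp]:
  assumes "f \<in> Mor A" "f' \<in> Mor A" "Dom A f = Dom A f'" "Cod A f = Cod A f'"
  shows "\<lbrakk>g \<in> Mor A; Cod A f' = Dom A g\<rbrakk> \<Longrightarrow> g \<cdot> (f +\<^bsub>A\<^esub> f') = g \<cdot> f +\<^bsub>A\<^esub> g \<cdot> f'"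
    and "\<lbrakk>g \<in> Mor A; Cod A g = Dom A f'\<rbrakk> \<Longrightarrow> (f +\<^bsub>A\<^esub> f') \<cdot> g = f \<cdot> g +\<^bsub>A\<^esub> f' \<cdot> g"
  using cmp_add_right[of f "Dom A f" "Cod A f" f' g] cmp_add_left[of g "Dom A g" _ f _ f'] assms
  by (auto simp: Hom_iff)

lemma add_idem_zero:
  assumes "f +\<^bsub>A\<^esub> f = f" "f \<in> Mor A"
  shows "f = zero (Dom A f) (Cod A f)"
  by (rule add_cancel[of f]) (use assms in auto)

lemma cmp_zero [simp]:
  assumes "f \<in> Mor A" "Z \<in> Obj A"
  shows "Cod A f = Y \<Longrightarrow> zero Y Z \<cdot> f = zero (Dom A f) Z"
    and "Dom A f = Y \<Longrightarrow> f \<cdot> zero Z Y = zero Z (Cod A f)"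
proof -
  assume "Cod A f = Y"
  hence Y: "Cod A f = Y" "Y \<in> Obj A" using assms by auto
  have "zero Y Z \<cdot> f +\<^bsub>A\<^esub> zero Y Z \<cdot> f = (zero Y Z +\<^bsub>A\<^esub> zero Y Z) \<cdot> f"
    by (rule distrib(2)[symmetric]) (use assms Y in auto)
  also have "\<dots> = zero Y Z \<cdot> f" using assms Y by (subst add_zero) auto
  finally show "zero Y Z \<cdot> f = zero (Dom A f) Z"
    using add_idem_zero[of "zero Y Z \<cdot> f"] assms Y by auto
next
  assume "Dom A f = Y"
  hence Y: "Dom A f = Y" "Y \<in> Obj A" using assms by auto
  have "f \<cdot> zero Z Y +\<^bsub>A\<^esub> f \<cdot> zero Z Y = f \<cdot> (zero Z Y +\<^bsub>A\<^esub> zero Z Y)"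
    by (rule distrib(1)[symmetric]) (use assms Y in auto)
  also have "\<dots> = f \<cdot> zero Z Y" using assms Y by (subst add_zero) auto
  finally show "f \<cdot> zero Z Y = zero Z (Cod A f)"
    using add_idem_zero[of "f \<cdot> zero Z Y"] assms Y by auto
qed

lemma mono_cancel_zero:
  assumes "is_mono A m" "f \<in> Mor A" "Cod A f = Dom A m" "m \<cdot> f = zero (Dom A f) (Cod A m)"
  shows "f = zero (Dom A f) (Cod A f)"
  by (rule mono_cancel[OF assms(1)]) (use assms mono_Mor[OF assms(1)] in auto)

lemma epi_cancel_zero:
  assumes "is_epi A m" "f \<in> Mor A" "Dom A f = Cod A m" "f \<cdot> m = zero (Dom A m) (Cod A f)"
  shows "f = zero (Dom A f) (Cod A f)"
  by (rule epi_cancel[OF assms(1)]) (use assms epi_Mor[OF assms(1)] in auto)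

lemma mono_if_kernel_zero:
  assumes "m \<in> Mor A"
    and "\<And>x. \<lbrakk>x \<in> Mor A; Cod A x = Dom A m; m \<cdot> x = zero (Dom A x) (Cod A m)\<rbrakk>
      \<Longrightarrow> x = zero (Dom A x) (Dom A m)"
  shows "is_mono A m"
  unfolding is_mono_def
proof (intro conjI allI ballI impI)
  show "m \<in> Mor A" by fact
  fix X f g assume a: "f \<in> Hom A X (Dom A m)" "g \<in> Hom A X (Dom A m)" "m \<cdot> f = m \<cdot> g"
  hence fg: "f \<in> Mor A" "g \<in> Mor A" "Dom A f = Dom A g" "Cod A f = Dom A m" "Cod A g = Dom A m"
    by (auto simp: Hom_iff)
  obtain h where h: "h \<in> Mor A" "Dom A h = Dom A g" "Cod A h = Cod A g" "f +\<^bsub>A\<^esub> h = g"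
    using complement_exists[of f g] fg by auto
  have "m \<cdot> f +\<^bsub>A\<^esub> m \<cdot> h = m \<cdot> g" using distrib(1)[of f h m] assms(1) fg h by auto
  hence "m \<cdot> f +\<^bsub>A\<^esub> m \<cdot> h = m \<cdot> f +\<^bsub>A\<^esub> zero (Dom A f) (Cod A m)"
    using a fg assms(1) by simp
  hence "m \<cdot> h = zero (Dom A f) (Cod A m)"
    by (rule add_cancel) (use fg h assms in auto)
  hence "h = zero (Dom A h) (Dom A m)" using fg h by (intro assms(2)) auto
  thus "f = g" using h fg by (metis add_zero(1))
qed

text \<open>The definitions of essential and superfluous subobjects ask for zero objects; calculations need
  equations between morphisms. If \<open>m = 0\<close>, cancelling \<open>m\<close> in \<open>m \<cdot> 1 = m \<cdot> 0\<close> shows that the identity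
  of the domain is zero, which makes the domain a zero object.\<close>

lemma zero_object_mono_iff:
  assumes "is_mono A m"
  shows "zero_object A (Dom A m) \<longleftrightarrow> m = zero (Dom A m) (Cod A m)"
proof
  have m: "m \<in> Mor A" using assms by (rule mono_Mor)
  {
    assume "zero_object A (Dom A m)"
    hence "\<exists>!f. f \<in> Hom A (Dom A m) (Cod A m)" using m by (auto simp: zero_object_def)
    moreover have "m \<in> Hom A (Dom A m) (Cod A m)" "zero (Dom A m) (Cod A m) \<in> Hom A (Dom A m) (Cod A m)"
      using m by (auto simp: Hom_iff)
    ultimately show "m = zero (Dom A m) (Cod A m)" by blast
  }
  {
    assume z: "m = zero (Dom A m) (Cod A m)"
    have *: "f = zero (Dom A f) (Dom A m)" if "f \<in> Mor A" "Cod A f = Dom A m" for f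
    proof -
      have "m \<cdot> f = zero (Dom A f) (Cod A m)" by (subst z) (use that m in auto)
      thus ?thesis using mono_cancel_zero[OF assms that] that by simp
    qed
    have i: "Ide A (Dom A m) = zero (Dom A m) (Dom A m)" using *[of "Ide A (Dom A m)"] m by simp
    have **: "f = zero (Dom A m) (Cod A f)" if "f \<in> Mor A" "Dom A f = Dom A m" for f
    proof -
      have "f = f \<cdot> Ide A (Dom A m)" using that m by simp
      also have "\<dots> = zero (Dom A m) (Cod A f)" unfolding i using that m by simp
      finally show ?thesis .
    qed
    show "zero_object A (Dom A m)"
      unfolding zero_object_def
    proof (intro conjI ballI)
      fix X assume X: "X \<in> Obj A"
      show "\<exists>!f. f \<in> Hom A X (Dom A m)"
        by (rule ex1I[of _ "zero X (Dom A m)"]) (use * X m in \<open>auto simp: Hom_iff\<close>)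
      show "\<exists>!f. f \<in> Hom A (Dom A m) X"
        by (rule ex1I[of _ "zero (Dom A m) X"]) (use ** X m in \<open>auto simp: Hom_iff\<close>)
    qed (use m in simp)
  }
qed

lemma kernelD:
  assumes "is_kernel A f k"
  shows "k \<in> Mor A" "Cod A k = Dom A f" "f \<cdot> k = zero (Dom A k) (Cod A f)"
  using assms by (auto simp: is_kernel_def)

lemma kernel_factors:
  assumes "is_kernel A f k" "g \<in> Mor A" "Cod A g = Dom A f" "f \<cdot> g = zero (Dom A g) (Cod A f)"
  shows "factors_through A g k"
proof -
  have "g \<in> Hom A (Dom A g) (Dom A f)" using assms by (auto simp: Hom_iff)
  hence "\<exists>u. u \<in> Hom A (Dom A g) (Dom A k) \<and> k \<cdot> u = g"
    using assms(1,4) unfolding is_kernel_def by blast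
  thus ?thesis unfolding factors_through_def by blast
qed

lemma kernel_mono:
  assumes "is_kernel A f k" "f \<in> Mor A"
  shows "is_mono A k"
  unfolding is_mono_def
proof (intro conjI allI ballI impI)
  note k = kernelD[OF assms(1)]
  show "k \<in> Mor A" by (rule k)
  fix X a b assume a: "a \<in> Hom A X (Dom A k)" "b \<in> Hom A X (Dom A k)" "k \<cdot> a = k \<cdot> b"
  have X: "X \<in> Obj A" using a by (auto simp: Hom_iff)
  have 1: "k \<cdot> b \<in> Hom A X (Dom A f)" using a k by (auto simp: Hom_iff)
  have 2: "f \<cdot> (k \<cdot> b) = zero X (Cod A f)"
    using a k assms(2) X by (simp add: Hom_iff cmp_extend[OF k(3)])
  from 1 2 have "\<exists>!u. u \<in> Hom A X (Dom A k) \<and> k \<cdot> u = k \<cdot> b"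
    using assms(1) unfolding is_kernel_def by blast
  thus "a = b" using a by metis
qed

end

section \<open>The opposite category\<close>

text \<open>All the data and axioms of an abelian category are invariant under reversing arrows, so that
  every lemma about kernels, monomorphisms and injectives gives one about cokernels, epimorphisms and
  projectives.\<close>

definition dual :: "('o, 'm) cat_struct \<Rightarrow> ('o, 'm) cat_struct" where
  "dual A = \<lparr>Obj = Obj A, Mor = Mor A, Dom = Cod A, Cod = Dom A, Ide = Ide A,
     cmp = (\<lambda>g f. f \<cdot>\<^bsub>A\<^esub> g), add_mor = add_mor A, zero_mor = (\<lambda>X Y. zero_mor A Y X)\<rparr>"

lemma dual_simps [simp]:
  "Obj (dual A) = Obj A" "Mor (dual A) = Mor A" "Dom (dual A) = Cod A" "Cod (dual A) = Dom A"
  "Ide (dual A) = Ide A" "g \<cdot>\<^bsub>dual A\<^esub> f = f \<cdot>\<^bsub>A\<^esub> g" "add_mor (dual A) = add_mor A"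
  "zero_mor (dual A) X Y = zero_mor A Y X"
  by (simp_all add: dual_def)

lemma Hom_dual [simp]: "Hom (dual A) X Y = Hom A Y X"
  by (auto simp: Hom_iff)

lemma is_mono_dual [simp]: "is_mono (dual A) = is_epi A"
  by (simp add: fun_eq_iff is_mono_def is_epi_def)

lemma is_epi_dual [simp]: "is_epi (dual A) = is_mono A"
  by (simp add: fun_eq_iff is_mono_def is_epi_def)

lemma is_kernel_dual [simp]: "is_kernel (dual A) = is_cokernel A"
  by (simp add: fun_eq_iff is_kernel_def is_cokernel_def)

lemma is_cokernel_dual [simp]: "is_cokernel (dual A) = is_kernel A"
  by (simp add: fun_eq_iff is_kernel_def is_cokernel_def)

lemma Ker_dual [simp]: "Ker (dual A) = Coker A"
  by (simp add: fun_eq_iff Ker_def Coker_def)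

lemma Coker_dual [simp]: "Coker (dual A) = Ker A"
  by (simp add: fun_eq_iff Ker_def Coker_def)

lemma zero_object_dual [simp]: "zero_object (dual A) = zero_object A"
  by (auto simp: fun_eq_iff zero_object_def)

lemma is_direct_sum_dual [simp]:
  "is_direct_sum (dual A) X Y S i j p q = is_direct_sum A X Y S p q i j"
  by (auto simp: is_direct_sum_def)

lemma injective_object_dual [simp]: "injective_object (dual A) = projective_object A"
  by (simp add: fun_eq_iff injective_object_def projective_object_def)

lemma enough_injectives_dual [simp]: "enough_injectives (dual A) = enough_projectives A"
  by (simp add: enough_injectives_def enough_projectives_def)

lemma closed_under_direct_sums_dual [simp]:
  "closed_under_direct_sums (dual A) \<C> = closed_under_direct_sums A \<C>"
  by (simp add: closed_under_direct_sums_def) blast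

lemma abelian_category_dual:
  assumes "abelian_category A"
  shows "abelian_category (dual A)"
proof -
  interpret abelian_category A by fact
  have hg: "Hom_group (dual A) X Y = Hom_group A Y X" for X Y
    by (simp add: Hom_group_def)
  show ?thesis
  proof (intro abelian_category.intro preadditive_category.intro category.intro
      preadditive_category_axioms.intro abelian_category_axioms.intro)
    fix f g h X Y Z W
    assume "f \<in> Hom (dual A) X Y" "g \<in> Hom (dual A) Y Z" "h \<in> Hom (dual A) Z W"
    thus "(h \<cdot>\<^bsub>dual A\<^esub> g) \<cdot>\<^bsub>dual A\<^esub> f = h \<cdot>\<^bsub>dual A\<^esub> (g \<cdot>\<^bsub>dual A\<^esub> f)"
      using cmp_assoc[of h W Z g Y f X] by simp
  next
    fix X Y assume "X \<in> Obj (dual A)" "Y \<in> Obj (dual A)"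
    thus "\<exists>S i j p q. is_direct_sum (dual A) X Y S i j p q"
      using direct_sum_exists[of X Y] by simp blast
  qed (use zero_object_exists kernel_exists cokernel_exists mono_normal epi_normal
      Hom_comm_group cmp_add_left cmp_add_right cmp_in_Hom Ide_in_Hom in \<open>simp_all add: hg Hom_iff\<close>)
qed


section \<open>Kernels, cokernels and the lattice of subobjects\<close>

lemma sub_carrier [simp]: "k \<in> carrier (Sub A M) \<longleftrightarrow> is_mono A k \<and> Cod A k = M"
  by (simp add: Sub_def)

lemma sub_le [simp]: "k \<sqsubseteq>\<^bsub>Sub A M\<^esub> l \<longleftrightarrow> factors_through A k l"
  by (simp add: Sub_def)

lemma sub_eq [simp]: "k .=\<^bsub>Sub A M\<^esub> l \<longleftrightarrow> factors_through A k l \<and> factors_through A l k"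
  by (simp add: Sub_def)

context abelian_category
begin

lemma abelian_category_op: "abelian_category (dual A)"
  by (rule abelian_category_dual) unfold_locales

interpretation op: abelian_category "dual A"
  by (rule abelian_category_op)

lemma Ker_is_kernel: "f \<in> Mor A \<Longrightarrow> is_kernel A f (Ker A f)"
  unfolding Ker_def by (rule someI_ex) (rule kernel_exists)

lemma Coker_is_cokernel: "f \<in> Mor A \<Longrightarrow> is_cokernel A f (Coker A f)"
  unfolding Coker_def by (rule someI_ex) (rule cokernel_exists)

lemma Ker_simps [simp]:
  assumes "f \<in> Mor A"
  shows "Ker A f \<in> Mor A" "Cod A (Ker A f) = Dom A f" "is_mono A (Ker A f)"
    "f \<cdot> Ker A f = zero (Dom A (Ker A f)) (Cod A f)"
  using kernelD[OF Ker_is_kernel[OF assms]] kernel_mono[OF Ker_is_kernel[OF assms] assms] by auto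

lemma Coker_simps [simp]:
  assumes "f \<in> Mor A"
  shows "Coker A f \<in> Mor A" "Dom A (Coker A f) = Cod A f" "is_epi A (Coker A f)"
    "Coker A f \<cdot> f = zero (Dom A f) (Cod A (Coker A f))"
  using op.kernelD[of f "Coker A f"] op.kernel_mono[of f "Coker A f"] Coker_is_cokernel[OF assms] assms
  by auto

lemma factors_through_Ker_iff:
  assumes "f \<in> Mor A" "g \<in> Mor A" "Cod A g = Dom A f"
  shows "factors_through A g (Ker A f) \<longleftrightarrow> f \<cdot> g = zero (Dom A g) (Cod A f)"
proof
  assume "factors_through A g (Ker A f)"
  then obtain h where h: "h \<in> Mor A" "Dom A h = Dom A g" "Cod A h = Dom A (Ker A f)"
    "Ker A f \<cdot> h = g" by (rule factors_throughE)
  have "f \<cdot> (Ker A f \<cdot> h) = zero (Dom A (Ker A f)) (Cod A f) \<cdot> h"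
    by (rule cmp_extend) (use assms h in auto)
  thus "f \<cdot> g = zero (Dom A g) (Cod A f)" using h assms by simp
next
  assume "f \<cdot> g = zero (Dom A g) (Cod A f)"
  thus "factors_through A g (Ker A f)"
    by (intro kernel_factors[OF Ker_is_kernel]) (use assms in auto)
qed

lemma factors_through_Coker_iff:
  assumes "f \<in> Mor A" "g \<in> Mor A" "Dom A g = Cod A f"
  shows "factors_through (dual A) g (Coker A f) \<longleftrightarrow> g \<cdot> f = zero (Dom A f) (Cod A g)"
  using abelian_category.factors_through_Ker_iff[OF abelian_category_op, of f g] assms by simp

lemma factors_through_Coker:
  assumes "f \<in> Mor A" "g \<in> Mor A" "Dom A g = Cod A f" "g \<cdot> f = zero (Dom A f) (Cod A g)"
  obtains u where "u \<in> Mor A" "Dom A u = Cod A (Coker A f)" "Cod A u = Cod A g" "u \<cdot> Coker A f = g"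
proof -
  have "factors_through (dual A) g (Coker A f)"
    using factors_through_Coker_iff assms by simp
  thus ?thesis by (rule op.factors_throughE) (use that in auto)
qed

text \<open>In an abelian category every monomorphism is the kernel of its cokernel, so that the morphisms
  factoring through it can be recognised by an equation.\<close>

lemma factors_through_mono_iff:
  assumes "is_mono A m" "g \<in> Mor A" "Cod A g = Cod A m"
  shows "factors_through A g m \<longleftrightarrow> Coker A m \<cdot> g = zero (Dom A g) (Cod A (Coker A m))"
proof
  have m: "m \<in> Mor A" using assms(1) by (rule mono_Mor)
  {
    assume "factors_through A g m"
    then obtain h where h: "h \<in> Mor A" "Dom A h = Dom A g" "Cod A h = Dom A m" "m \<cdot> h = g"
      by (rule factors_throughE)
    have "Coker A m \<cdot> (m \<cdot> h) = zero (Dom A m) (Cod A (Coker A m)) \<cdot> h"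
      by (rule cmp_extend) (use m h in auto)
    thus "Coker A m \<cdot> g = zero (Dom A g) (Cod A (Coker A m))" using h m by simp
  }
  {
    assume z: "Coker A m \<cdot> g = zero (Dom A g) (Cod A (Coker A m))"
    obtain f where f: "f \<in> Mor A" "is_kernel A f m" using mono_normal[OF assms(1)] by auto
    note k = kernelD[OF f(2)]
    obtain u where u: "u \<in> Mor A" "Dom A u = Cod A (Coker A m)" "Cod A u = Cod A f"
      "u \<cdot> Coker A m = f"
      by (rule factors_through_Coker[OF m f(1)]) (use k in auto)
    have "u \<cdot> (Coker A m \<cdot> g) = f \<cdot> g"
      by (rule cmp_extend) (use u m assms in auto)
    hence "f \<cdot> g = zero (Dom A g) (Cod A f)" using u m z assms by simp
    thus "factors_through A g m" using kernel_factors[OF f(2)] assms k by simp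
  }
qed

lemma Ker_Coker_mono:
  assumes "is_mono A m"
  shows "factors_through A m (Ker A (Coker A m))" "factors_through A (Ker A (Coker A m)) m"
proof -
  have m: "m \<in> Mor A" using assms by (rule mono_Mor)
  show "factors_through A m (Ker A (Coker A m))" using m by (simp add: factors_through_Ker_iff)
  show "factors_through A (Ker A (Coker A m)) m" using m assms by (simp add: factors_through_mono_iff)
qed

text \<open>The intersection of \<open>k\<close> and \<open>l\<close> is obtained by restricting \<open>k\<close> to the kernel of its composite
  with the cokernel of \<open>l\<close>. The last conclusion is about arbitrary morphisms \<open>x\<close>, not only
  monomorphisms: the intersection is a pullback.\<close>

lemma meet_exists:
  assumes "is_mono A k" "Cod A k = M" "is_mono A l" "Cod A l = M"
  obtains m where "is_mono A m" "Cod A m = M" "factors_through A m k" "factors_through A m l"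
    "\<And>x. \<lbrakk>x \<in> Mor A; factors_through A x k; factors_through A x l\<rbrakk> \<Longrightarrow> factors_through A x m"
proof -
  have kl: "k \<in> Mor A" "l \<in> Mor A" using assms by (auto intro: mono_Mor)
  define w where "w = Ker A (Coker A l \<cdot> k)"
  have w: "w \<in> Mor A" "Cod A w = Dom A k" "is_mono A w"
    using Ker_simps[of "Coker A l \<cdot> k"] kl assms unfolding w_def by auto
  have "(Coker A l \<cdot> k) \<cdot> w = zero (Dom A w) (Cod A (Coker A l))"
    using Ker_simps(4)[of "Coker A l \<cdot> k"] kl assms unfolding w_def by simp
  hence lkw: "Coker A l \<cdot> (k \<cdot> w) = zero (Dom A w) (Cod A (Coker A l))"
    using w kl assms by simp
  show ?thesis
  proof (rule that[of "k \<cdot> w"])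
    show "is_mono A (k \<cdot> w)" by (rule mono_cmp) (use w assms in auto)
    show "Cod A (k \<cdot> w) = M" using w assms kl by simp
    show "factors_through A (k \<cdot> w) k" by (rule factors_throughI) (use w kl in auto)
    show "factors_through A (k \<cdot> w) l"
      using factors_through_mono_iff[OF assms(3)] lkw w kl assms by simp
    fix x assume x: "x \<in> Mor A" "factors_through A x k" "factors_through A x l"
    obtain h where h: "h \<in> Mor A" "Dom A h = Dom A x" "Cod A h = Dom A k" "k \<cdot> h = x"
      using x(2) by (rule factors_throughE)
    have "Cod A x = Cod A k" unfolding h(4)[symmetric] using h(1-3) kl by simp
    hence "Coker A l \<cdot> (k \<cdot> h) = zero (Dom A x) (Cod A (Coker A l))"
      using factors_through_mono_iff[OF assms(3) x(1)] x(3) assms h by simp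
    hence "factors_through A h w"
      unfolding w_def using factors_through_Ker_iff[of "Coker A l \<cdot> k" h] kl h assms by simp
    then obtain t where t: "t \<in> Mor A" "Dom A t = Dom A h" "Cod A t = Dom A w" "w \<cdot> t = h"
      by (rule factors_throughE)
    show "factors_through A x (k \<cdot> w)"
      by (rule factors_throughI[of _ t]) (use t h w kl in auto)
  qed
qed

text \<open>The lattice operation is a choice among the greatest lower bounds, so that each of them has the
  properties of the pullback constructed above.\<close>

lemma meet_props:
  assumes "is_mono A k" "Cod A k = M" "is_mono A l" "Cod A l = M"
  shows "is_mono A (k \<sqinter>\<^bsub>Sub A M\<^esub> l)" "Cod A (k \<sqinter>\<^bsub>Sub A M\<^esub> l) = M"
    "factors_through A (k \<sqinter>\<^bsub>Sub A M\<^esub> l) k" "factors_through A (k \<sqinter>\<^bsub>Sub A M\<^esub> l) l"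
    "\<lbrakk>x \<in> Mor A; factors_through A x k; factors_through A x l\<rbrakk>
      \<Longrightarrow> factors_through A x (k \<sqinter>\<^bsub>Sub A M\<^esub> l)"
proof -
  obtain m where m: "is_mono A m" "Cod A m = M" "factors_through A m k" "factors_through A m l"
    "\<And>x. \<lbrakk>x \<in> Mor A; factors_through A x k; factors_through A x l\<rbrakk> \<Longrightarrow> factors_through A x m"
    using meet_exists[OF assms] by blast
  have Lower: "x \<in> Lower (Sub A M) {k, l} \<longleftrightarrow>
      is_mono A x \<and> Cod A x = M \<and> factors_through A x k \<and> factors_through A x l" for x
    using assms by (auto simp: Lower_def)
  have "greatest (Sub A M) m (Lower (Sub A M) {k, l})"
    unfolding greatest_def
  proof (intro conjI ballI)
    show "Lower (Sub A M) {k, l} \<subseteq> carrier (Sub A M)" by (auto simp: Lower_def)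
    show "m \<in> Lower (Sub A M) {k, l}" using m unfolding Lower by blast
    fix x assume "x \<in> Lower (Sub A M) {k, l}"
    thus "x \<sqsubseteq>\<^bsub>Sub A M\<^esub> m" using m(5) mono_Mor unfolding Lower sub_le by blast
  qed
  hence g: "greatest (Sub A M) (k \<sqinter>\<^bsub>Sub A M\<^esub> l) (Lower (Sub A M) {k, l})"
    unfolding meet_def inf_def by (rule someI)
  thus p: "is_mono A (k \<sqinter>\<^bsub>Sub A M\<^esub> l)" "Cod A (k \<sqinter>\<^bsub>Sub A M\<^esub> l) = M"
    "factors_through A (k \<sqinter>\<^bsub>Sub A M\<^esub> l) k" "factors_through A (k \<sqinter>\<^bsub>Sub A M\<^esub> l) l"
    using assms by (auto simp: greatest_def Lower)
  have "factors_through A m (k \<sqinter>\<^bsub>Sub A M\<^esub> l)"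
    using g m assms by (auto simp: greatest_def Lower)
  moreover assume "x \<in> Mor A" "factors_through A x k" "factors_through A x l"
  ultimately show "factors_through A x (k \<sqinter>\<^bsub>Sub A M\<^esub> l)"
    using m(5) factors_through_trans p(1) mono_Mor by blast
qed

text \<open>The sum of \<open>k\<close> and \<open>l\<close> is the kernel of the intersection, in the opposite category, of their
  cokernels. The last conclusion says that a morphism killing \<open>k\<close> and \<open>l\<close> kills their sum; it holds
  because its kernel is an upper bound.\<close>

lemma join_props:
  assumes "is_mono A k" "Cod A k = M" "is_mono A l" "Cod A l = M"
  shows "is_mono A (k \<squnion>\<^bsub>Sub A M\<^esub> l)" "Cod A (k \<squnion>\<^bsub>Sub A M\<^esub> l) = M"
    "factors_through A k (k \<squnion>\<^bsub>Sub A M\<^esub> l)" "factors_through A l (k \<squnion>\<^bsub>Sub A M\<^esub> l)"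
    "\<lbrakk>c \<in> Mor A; Dom A c = M; c \<cdot> k = zero (Dom A k) (Cod A c); c \<cdot> l = zero (Dom A l) (Cod A c)\<rbrakk>
      \<Longrightarrow> c \<cdot> (k \<squnion>\<^bsub>Sub A M\<^esub> l) = zero (Dom A (k \<squnion>\<^bsub>Sub A M\<^esub> l)) (Cod A c)"
proof -
  have kl: "k \<in> Mor A" "l \<in> Mor A" using assms by (auto intro: mono_Mor)
  obtain m where m: "is_epi A m" "Dom A m = M" "factors_through (dual A) m (Coker A k)"
    "factors_through (dual A) m (Coker A l)"
    "\<And>x. \<lbrakk>x \<in> Mor A; factors_through (dual A) x (Coker A k); factors_through (dual A) x (Coker A l)\<rbrakk>
      \<Longrightarrow> factors_through (dual A) x m"
    using abelian_category.meet_exists[OF abelian_category_op, of "Coker A k" M "Coker A l"] kl assms by auto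
  have mm: "m \<in> Mor A" using m(1) by (rule epi_Mor)
  have kills: "factors_through (dual A) x (Coker A y) \<longleftrightarrow> factors_through A y (Ker A x)"
    if "x \<in> Mor A" "y \<in> Mor A" "Dom A x = Cod A y" for x y
    using that by (simp add: factors_through_Coker_iff factors_through_Ker_iff)
  have ker: "factors_through (dual A) x m \<Longrightarrow> factors_through A (Ker A m) (Ker A x)"
    if "x \<in> Mor A" "Dom A x = M" for x
  proof -
    assume "factors_through (dual A) x m"
    then obtain h where h: "h \<in> Mor A" "Cod A m = Dom A h" "Cod A h = Cod A x" "h \<cdot> m = x"
      by (rule op.factors_throughE) auto
    have "h \<cdot> (m \<cdot> Ker A m) = x \<cdot> Ker A m" by (rule cmp_extend) (use h mm in auto)
    hence "x \<cdot> Ker A m = zero (Dom A (Ker A m)) (Cod A x)" using h mm by simp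
    thus ?thesis using that mm m(2) by (simp add: factors_through_Ker_iff)
  qed
  \<comment> \<open>An upper bound \<open>z\<close> is the kernel of its cokernel, which kills \<open>k\<close> and \<open>l\<close> and therefore
    factors through \<open>m\<close>.\<close>
  have "least (Sub A M) (Ker A m) (Upper (Sub A M) {k, l})"
    unfolding least_def
  proof (intro conjI ballI)
    show "Upper (Sub A M) {k, l} \<subseteq> carrier (Sub A M)" by (auto simp: Upper_def)
    show "Ker A m \<in> Upper (Sub A M) {k, l}"
      using kills[OF mm kl(1)] kills[OF mm kl(2)] m mm assms by (auto simp: Upper_def)
    fix z assume "z \<in> Upper (Sub A M) {k, l}"
    hence z: "is_mono A z" "Cod A z = M" "factors_through A k z" "factors_through A l z"
      using assms by (auto simp: Upper_def)
    have zm: "z \<in> Mor A" using z(1) by (rule mono_Mor)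
    have "factors_through A k (Ker A (Coker A z))" "factors_through A l (Ker A (Coker A z))"
      using z Ker_Coker_mono(1)[OF z(1)] factors_through_trans zm by auto
    hence "factors_through (dual A) (Coker A z) m"
      using kills[of "Coker A z" k] kills[of "Coker A z" l] zm kl z assms by (intro m(5)) auto
    hence "factors_through A (Ker A m) (Ker A (Coker A z))"
      using ker[of "Coker A z"] zm z by simp
    thus "Ker A m \<sqsubseteq>\<^bsub>Sub A M\<^esub> z"
      using Ker_Coker_mono(2)[OF z(1)] factors_through_trans zm by auto
  qed
  hence g: "least (Sub A M) (k \<squnion>\<^bsub>Sub A M\<^esub> l) (Upper (Sub A M) {k, l})"
    unfolding join_def sup_def by (rule someI)
  thus p: "is_mono A (k \<squnion>\<^bsub>Sub A M\<^esub> l)" "Cod A (k \<squnion>\<^bsub>Sub A M\<^esub> l) = M"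
    "factors_through A k (k \<squnion>\<^bsub>Sub A M\<^esub> l)" "factors_through A l (k \<squnion>\<^bsub>Sub A M\<^esub> l)"
    using assms by (auto simp: least_def Upper_def)
  assume c: "c \<in> Mor A" "Dom A c = M" "c \<cdot> k = zero (Dom A k) (Cod A c)"
    "c \<cdot> l = zero (Dom A l) (Cod A c)"
  hence "Ker A c \<in> Upper (Sub A M) {k, l}"
    using kl assms by (auto simp: Upper_def factors_through_Ker_iff)
  hence "factors_through A (k \<squnion>\<^bsub>Sub A M\<^esub> l) (Ker A c)" using g by (auto simp: least_def)
  thus "c \<cdot> (k \<squnion>\<^bsub>Sub A M\<^esub> l) = zero (Dom A (k \<squnion>\<^bsub>Sub A M\<^esub> l)) (Cod A c)"
    using c p mono_Mor[OF p(1)] by (simp add: factors_through_Ker_iff)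
qed

end


section \<open>Essential subobjects of direct summands\<close>

text \<open>For monomorphisms \<open>x\<close> and \<open>k\<close> this is the vanishing of the intersection, tested on
  the morphisms \<open>x \<cdot> v\<close> that factor through \<open>k\<close>. Unlike the lattice operation it needs no choice of
  an intersection, and it can be read in the opposite category.\<close>

definition meets_trivially :: "('o, 'm) cat_struct \<Rightarrow> 'm \<Rightarrow> 'm \<Rightarrow> bool" where
  "meets_trivially A x k \<longleftrightarrow> (\<forall>v\<in>Mor A. Cod A v = Dom A x \<and> factors_through A (x \<cdot>\<^bsub>A\<^esub> v) k
     \<longrightarrow> x \<cdot>\<^bsub>A\<^esub> v = zero_mor A (Dom A v) (Cod A x))"

text \<open>The direct summand in which \<open>k\<close> is to be essential is given by the idempotent \<open>e\<close> of which it is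
  the image: a morphism \<open>x\<close> factors through this image iff \<open>e \<cdot> x = x\<close>. Thus the condition says that
  \<open>k\<close> lies in the image of \<open>e\<close>, and that a subobject \<open>x\<close> of this image which meets \<open>k\<close> trivially is
  zero.\<close>

definition essential_split :: "('o, 'm) cat_struct \<Rightarrow> 'o \<Rightarrow> 'm \<Rightarrow> bool" where
  "essential_split A M k \<longleftrightarrow> (\<exists>e\<in>Hom A M M. e \<cdot>\<^bsub>A\<^esub> e = e \<and> e \<cdot>\<^bsub>A\<^esub> k = k \<and>
     (\<forall>x. is_mono A x \<and> Cod A x = M \<and> e \<cdot>\<^bsub>A\<^esub> x = x \<and> meets_trivially A x k
        \<longrightarrow> x = zero_mor A (Dom A x) M))"

context abelian_category
begin

lemma meets_triviallyD:
  assumes "meets_trivially A x k" "v \<in> Mor A" "Cod A v = Dom A x" "factors_through A (x \<cdot> v) k"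
  shows "x \<cdot> v = zero (Dom A v) (Cod A x)"
  using assms unfolding meets_trivially_def by blast

lemma meets_triviallyI:
  assumes "\<And>v. \<lbrakk>v \<in> Mor A; Cod A v = Dom A x; factors_through A (x \<cdot> v) k\<rbrakk>
    \<Longrightarrow> x \<cdot> v = zero (Dom A v) (Cod A x)"
  shows "meets_trivially A x k"
  using assms unfolding meets_trivially_def by blast

lemma essential_splitE:
  assumes "essential_split A M k"
  obtains e where "e \<in> Mor A" "Dom A e = M" "Cod A e = M" "e \<cdot> e = e" "e \<cdot> k = k"
    "\<And>x. \<lbrakk>is_mono A x; Cod A x = M; e \<cdot> x = x; meets_trivially A x k\<rbrakk> \<Longrightarrow> x = zero (Dom A x) M"
proof -
  from assms obtain e where "e \<in> Hom A M M" "e \<cdot> e = e" "e \<cdot> k = k"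
    "\<forall>x. is_mono A x \<and> Cod A x = M \<and> e \<cdot> x = x \<and> meets_trivially A x k \<longrightarrow> x = zero (Dom A x) M"
    unfolding essential_split_def by blast
  thus ?thesis by (intro that[of e]) (simp_all add: Hom_iff)
qed

lemma essential_splitI:
  assumes "e \<in> Mor A" "Dom A e = M" "Cod A e = M" "e \<cdot> e = e" "e \<cdot> k = k"
    "\<And>x. \<lbrakk>x \<in> Mor A; is_mono A x; Cod A x = M; e \<cdot> x = x; meets_trivially A x k\<rbrakk>
      \<Longrightarrow> x = zero (Dom A x) M"
  shows "essential_split A M k"
  unfolding essential_split_def
  by (rule bexI[of _ e]) (use assms mono_Mor in \<open>auto simp: Hom_iff\<close>)

lemma zero_object_meet_iff:
  assumes "is_mono A k" "Cod A k = L" "is_mono A x" "Cod A x = L"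
  shows "zero_object A (Dom A (k \<sqinter>\<^bsub>Sub A L\<^esub> x)) \<longleftrightarrow> meets_trivially A x k"
proof -
  define m where "m = k \<sqinter>\<^bsub>Sub A L\<^esub> x"
  note m = meet_props[OF assms, folded m_def]
  have mor: "m \<in> Mor A" "k \<in> Mor A" "x \<in> Mor A" using m assms by (auto intro: mono_Mor)
  have "m = zero (Dom A m) L \<longleftrightarrow> meets_trivially A x k"
  proof
    assume z: "m = zero (Dom A m) L"
    show "meets_trivially A x k"
    proof (rule meets_triviallyI)
      fix v assume v: "v \<in> Mor A" "Cod A v = Dom A x" "factors_through A (x \<cdot> v) k"
      have "factors_through A (x \<cdot> v) x" by (rule factors_throughI) (use v mor in auto)
      hence "factors_through A (x \<cdot> v) m" using m(5) v mor by simp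
      then obtain h where h: "h \<in> Mor A" "Dom A h = Dom A (x \<cdot> v)" "Cod A h = Dom A m"
        "m \<cdot> h = x \<cdot> v" by (rule factors_throughE)
      have "m \<cdot> h = zero (Dom A h) L"
        by (subst z) (use h assms mor in auto)
      thus "x \<cdot> v = zero (Dom A v) (Cod A x)" using h v mor assms by simp
    qed
  next
    assume t: "meets_trivially A x k"
    obtain h where h: "h \<in> Mor A" "Dom A h = Dom A m" "Cod A h = Dom A x" "x \<cdot> h = m"
      using m(4) by (rule factors_throughE)
    show "m = zero (Dom A m) L"
      using meets_triviallyD[OF t h(1,3)] h m(3) assms by simp
  qed
  thus ?thesis using zero_object_mono_iff[OF m(1)] m(2) unfolding m_def by simp
qed

lemma essential_iff:
  "essential A L k \<longleftrightarrow> is_mono A k \<and> Cod A k = L \<and>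
     (\<forall>x. is_mono A x \<and> Cod A x = L \<and> meets_trivially A x k \<longrightarrow> x = zero (Dom A x) L)"
  unfolding essential_def
  using zero_object_meet_iff[of k L] zero_object_mono_iff by auto

lemma direct_sumD:
  assumes "is_direct_sum A X Y S i j p q"
  shows "i \<in> Mor A" "Dom A i = X" "Cod A i = S" "j \<in> Mor A" "Dom A j = Y" "Cod A j = S"
    "p \<in> Mor A" "Dom A p = S" "Cod A p = X" "q \<in> Mor A" "Dom A q = S" "Cod A q = Y"
    "X \<in> Obj A" "Y \<in> Obj A" "S \<in> Obj A"
    "p \<cdot> i = Ide A X" "q \<cdot> j = Ide A Y" "p \<cdot> j = zero Y X" "q \<cdot> i = zero X Y"
    "i \<cdot> p +\<^bsub>A\<^esub> j \<cdot> q = Ide A S"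
  using assms by (auto simp: is_direct_sum_def Hom_iff)

lemma direct_sum_cmp:
  assumes "is_direct_sum A X Y S i j p q" "t \<in> Mor A"
  shows "Cod A t = X \<Longrightarrow> p \<cdot> (i \<cdot> t) = t" "Cod A t = Y \<Longrightarrow> q \<cdot> (j \<cdot> t) = t"
    "Cod A t = Y \<Longrightarrow> p \<cdot> (j \<cdot> t) = zero (Dom A t) X" "Cod A t = X \<Longrightarrow> q \<cdot> (i \<cdot> t) = zero (Dom A t) Y"
    "Cod A t = S \<Longrightarrow> i \<cdot> (p \<cdot> t) +\<^bsub>A\<^esub> j \<cdot> (q \<cdot> t) = t"
    "Dom A t = S \<Longrightarrow> t \<cdot> (i \<cdot> p) +\<^bsub>A\<^esub> t \<cdot> (j \<cdot> q) = t"
proof -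
  note d = direct_sumD[OF assms(1)]
  show "Cod A t = X \<Longrightarrow> p \<cdot> (i \<cdot> t) = t" "Cod A t = Y \<Longrightarrow> q \<cdot> (j \<cdot> t) = t"
    "Cod A t = Y \<Longrightarrow> p \<cdot> (j \<cdot> t) = zero (Dom A t) X" "Cod A t = X \<Longrightarrow> q \<cdot> (i \<cdot> t) = zero (Dom A t) Y"
    using cmp_extend[OF d(16), of t] cmp_extend[OF d(17), of t] cmp_extend[OF d(18), of t]
      cmp_extend[OF d(19), of t] d(1-15) assms(2) by auto
  show "i \<cdot> (p \<cdot> t) +\<^bsub>A\<^esub> j \<cdot> (q \<cdot> t) = t" if "Cod A t = S"
    using distrib(2)[of "i \<cdot> p" "j \<cdot> q" t] d that assms(2) by simp
  show "t \<cdot> (i \<cdot> p) +\<^bsub>A\<^esub> t \<cdot> (j \<cdot> q) = t" if "Dom A t = S"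
    using distrib(1)[of "i \<cdot> p" "j \<cdot> q" t] d that assms(2) by simp
qed

lemma direct_sum_swap:
  assumes "is_direct_sum A X Y S i j p q"
  shows "is_direct_sum A Y X S j i q p"
  using assms direct_sumD[OF assms] add_comm[of "i \<cdot> p" "j \<cdot> q"] unfolding is_direct_sum_def by auto

text \<open>The summands are the kernels of the complement \<open>1 - e\<close> and of \<open>e\<close>.\<close>

lemma idempotent_splits:
  assumes "e \<in> Mor A" "Dom A e = M" "Cod A e = M" "e \<cdot> e = e"
  obtains X Y d j p q where "is_direct_sum A X Y M d j p q" "d \<cdot> p = e"
proof -
  have M: "M \<in> Obj A" using assms by auto
  obtain e' where e': "e' \<in> Mor A" "Dom A e' = M" "Cod A e' = M" "e +\<^bsub>A\<^esub> e' = Ide A M"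
    using complement_exists[of e "Ide A M"] assms M by auto
  have l: "e \<cdot> t +\<^bsub>A\<^esub> e' \<cdot> t = t" if "t \<in> Mor A" "Cod A t = M" for t
    using distrib(2)[of e e' t] that assms e' by simp
  have r: "e \<cdot> e +\<^bsub>A\<^esub> e \<cdot> e' = e"
    using distrib(1)[of e e' e] assms(1-3) e' M by simp
  have ee': "e \<cdot> e' = zero M M"
    by (rule add_cancel[of e]) (use r assms e' M in auto)
  have e'e: "e' \<cdot> e = zero M M"
    by (rule add_cancel[of e]) (use l[of e] assms e' M in auto)
  define d where "d = Ker A e'"
  define j where "j = Ker A e"
  have d: "d \<in> Mor A" "Cod A d = M" "is_mono A d" "e' \<cdot> d = zero (Dom A d) M"
    using e' by (auto simp: d_def)
  have j: "j \<in> Mor A" "Cod A j = M" "is_mono A j" "e \<cdot> j = zero (Dom A j) M"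
    using assms by (auto simp: j_def)
  have "factors_through A e d" unfolding d_def using e' assms e'e by (simp add: factors_through_Ker_iff)
  then obtain p where p: "p \<in> Mor A" "Dom A p = M" "Cod A p = Dom A d" "d \<cdot> p = e"
    by (rule factors_throughE) (use assms in auto)
  have "factors_through A e' j" unfolding j_def using e' assms ee' by (simp add: factors_through_Ker_iff)
  then obtain q where q: "q \<in> Mor A" "Dom A q = M" "Cod A q = Dom A j" "j \<cdot> q = e'"
    by (rule factors_throughE) (use e' in auto)
  have dpd: "d \<cdot> (p \<cdot> d) = d"
    using cmp_extend[OF p(4), of d] l[of d] p d assms by simp
  have pd: "p \<cdot> d = Ide A (Dom A d)"
    by (rule mono_cancel[OF d(3)]) (use p d dpd in auto)
  have jqj: "j \<cdot> (q \<cdot> j) = j"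
    using cmp_extend[OF q(4), of j] l[of j] q j e' by simp
  have qj: "q \<cdot> j = Ide A (Dom A j)"
    by (rule mono_cancel[OF j(3)]) (use q j jqj in auto)
  have "d \<cdot> (p \<cdot> j) = zero (Dom A j) M"
    using cmp_extend[OF p(4), of j] p d j by simp
  hence pj: "p \<cdot> j = zero (Dom A j) (Dom A d)"
    using mono_cancel_zero[OF d(3), of "p \<cdot> j"] p d j by simp
  have "j \<cdot> (q \<cdot> d) = zero (Dom A d) M"
    using cmp_extend[OF q(4), of d] q d j by simp
  hence qd: "q \<cdot> d = zero (Dom A d) (Dom A j)"
    using mono_cancel_zero[OF j(3), of "q \<cdot> d"] q d j by simp
  have "is_direct_sum A (Dom A d) (Dom A j) M d j p q"
    unfolding is_direct_sum_def Hom_iff using d j p q pd qj pj qd e' by simp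
  thus ?thesis using p(4) by (rule that)
qed

text \<open>Subobjects of the summand \<open>d\<close> and subobjects \<open>x\<close> of \<open>M\<close> with \<open>d \<cdot> p \<cdot> x = x\<close> correspond to each
  other by composition with \<open>d\<close> and with \<open>p\<close>, and this correspondence preserves trivial
  intersections.\<close>

lemma essential_in_summand_iff:
  assumes "is_mono A k" "Cod A k = M"
  shows "essential_in_summand A M k \<longleftrightarrow> essential_split A M k"
proof
  have k: "k \<in> Mor A" using assms(1) by (rule mono_Mor)
  {
    assume "essential_in_summand A M k"
    then obtain d h Y j p q where dh: "h \<in> Hom A (Dom A k) (Dom A d)" "d \<cdot> h = k"
      "essential A (Dom A d) h" and sum: "is_direct_sum A (Dom A d) Y M d j p q"
      unfolding essential_in_summand_def direct_summand_def by metis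
    note s = direct_sumD[OF sum] and c = direct_sum_cmp[OF sum]
    have h: "h \<in> Mor A" "Cod A h = Dom A d" "Dom A h = Dom A k" using dh by (auto simp: Hom_iff)
    have pk: "p \<cdot> k = h" using c(1)[OF h(1,2)] dh(2) by simp
    show "essential_split A M k"
    proof (rule essential_splitI[of "d \<cdot> p"])
      show "d \<cdot> p \<in> Mor A" "Dom A (d \<cdot> p) = M" "Cod A (d \<cdot> p) = M" using s by simp_all
      show "(d \<cdot> p) \<cdot> (d \<cdot> p) = d \<cdot> p" using s c(1)[of p] by simp
      show "(d \<cdot> p) \<cdot> k = k" using s k assms pk dh by simp
      fix x assume xm: "x \<in> Mor A" and x: "is_mono A x" "Cod A x = M" "(d \<cdot> p) \<cdot> x = x"
        "meets_trivially A x k"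
      have dpx: "d \<cdot> (p \<cdot> x) = x" using x(2,3) xm s by simp
      have "is_mono A (p \<cdot> x)"
        by (rule mono_cmpD[of d]) (use dpx x(1,2) xm s in auto)
      moreover have "meets_trivially A (p \<cdot> x) h"
      proof (rule meets_triviallyI)
        fix v assume v: "v \<in> Mor A" "Cod A v = Dom A (p \<cdot> x)" "factors_through A ((p \<cdot> x) \<cdot> v) h"
        have v2: "Cod A v = Dom A x" using v(2) x(2) xm s by simp
        obtain u where u: "u \<in> Mor A" "Cod A u = Dom A h" "h \<cdot> u = p \<cdot> (x \<cdot> v)"
          using v(3) by (rule factors_throughE) (use v(1) v2 x(2) xm s in simp)
        have "k \<cdot> u = d \<cdot> (p \<cdot> (x \<cdot> v))"
          using cmp_extend[OF dh(2), of u] u h s(1) by simp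
        also have "\<dots> = x \<cdot> v" using cmp_extend[OF dpx, of v] v(1) v2 x(2) xm s by simp
        finally have "factors_through A (x \<cdot> v) k"
          by (rule factors_throughI) (use u h k in auto)
        hence "x \<cdot> v = zero (Dom A v) M" using meets_triviallyD[OF x(4) v(1) v2] x(2) by simp
        thus "(p \<cdot> x) \<cdot> v = zero (Dom A v) (Cod A (p \<cdot> x))" using v(1) v2 x(2) xm s by simp
      qed
      ultimately have "p \<cdot> x = zero (Dom A (p \<cdot> x)) (Dom A d)"
        using dh(3) xm x(2) s unfolding essential_iff by auto
      hence "d \<cdot> (p \<cdot> x) = zero (Dom A x) M" using xm x(2) s by simp
      thus "x = zero (Dom A x) M" using dpx by simp
    qed
  }
  {
    assume "essential_split A M k"
    then obtain e where e: "e \<in> Mor A" "Dom A e = M" "Cod A e = M" "e \<cdot> e = e" "e \<cdot> k = k"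
      and ess: "\<And>x. \<lbrakk>is_mono A x; Cod A x = M; e \<cdot> x = x; meets_trivially A x k\<rbrakk>
        \<Longrightarrow> x = zero (Dom A x) M"
      by (rule essential_splitE) blast
    obtain X Y d j p q where sum: "is_direct_sum A X Y M d j p q" and dp: "d \<cdot> p = e"
      using idempotent_splits e by blast
    note s = direct_sumD[OF sum] and c = direct_sum_cmp[OF sum]
    have d: "is_mono A d" by (rule split_mono[of p]) (use s in auto)
    define h where "h = p \<cdot> k"
    have h: "h \<in> Mor A" "Cod A h = X" "Dom A h = Dom A k" using s k assms by (auto simp: h_def)
    have dh: "d \<cdot> h = k" unfolding h_def using cmp_extend[OF dp, of k] s k assms e by simp
    have hm: "is_mono A h" by (rule mono_cmpD[of d]) (use dh h s assms in auto)
    have "essential A X h"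
      unfolding essential_iff
    proof (intro conjI allI impI; (elim conjE)?)
      fix x assume x: "is_mono A x" "Cod A x = X" "meets_trivially A x h"
      have xm: "x \<in> Mor A" using x(1) by (rule mono_Mor)
      have "d \<cdot> x = zero (Dom A (d \<cdot> x)) M"
      proof (rule ess)
        show "is_mono A (d \<cdot> x)" by (rule mono_cmp) (use x d s in auto)
        show "Cod A (d \<cdot> x) = M" using x xm s by simp
        show "e \<cdot> (d \<cdot> x) = d \<cdot> x"
          using cmp_extend[OF dp, of "d \<cdot> x"] c(1)[OF xm x(2)] x(2) xm s by simp
        show "meets_trivially A (d \<cdot> x) k"
        proof (rule meets_triviallyI)
          fix v assume v: "v \<in> Mor A" "Cod A v = Dom A (d \<cdot> x)" "factors_through A ((d \<cdot> x) \<cdot> v) k"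
          have v2: "Cod A v = Dom A x" using v(2) x(2) xm s by simp
          obtain u where u: "u \<in> Mor A" "Cod A u = Dom A k" "k \<cdot> u = d \<cdot> (x \<cdot> v)"
            using v(3) by (rule factors_throughE) (use v(1) v2 x(2) xm s in simp)
          have "d \<cdot> (h \<cdot> u) = d \<cdot> (x \<cdot> v)"
            using cmp_extend[OF dh, of u] u h s by simp
          hence "h \<cdot> u = x \<cdot> v"
            using mono_cancel[OF d, of "h \<cdot> u" "x \<cdot> v"] u h s xm x(2) v(1) v2 by simp
          hence "factors_through A (x \<cdot> v) h"
            by (rule factors_throughI) (use u h in auto)
          hence "x \<cdot> v = zero (Dom A v) X" using meets_triviallyD[OF x(3) v(1) v2] x(2) by simp
          thus "(d \<cdot> x) \<cdot> v = zero (Dom A v) (Cod A (d \<cdot> x))" using v(1) v2 x(2) xm s by simp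
        qed
      qed
      thus "x = zero (Dom A x) X" using mono_cancel_zero[OF d xm] x(2) xm s by simp
    qed (use hm h in auto)
    moreover have "direct_summand A M d"
      unfolding direct_summand_def using d s sum by auto
    moreover have "h \<in> Hom A (Dom A k) (Dom A d)" using h s by (simp add: Hom_iff)
    moreover have "k \<in> carrier (Sub A M)" using assms by simp
    ultimately show "essential_in_summand A M k"
      unfolding essential_in_summand_def using dh[symmetric] s(2) by metis
  }
qed

end


section \<open>Subobjects lying above direct summands\<close>

context abelian_category
begin

interpretation op: abelian_category "dual A"
  by (rule abelian_category_op)

text \<open>In terms of \<open>M\<close>, the quotient \<open>x\<close> meets \<open>Coker l\<close> trivially in the opposite category iff
  \<open>x \<cdot> l\<close> and \<open>x\<close> have the same image.\<close>

lemma meets_trivially_Coker_iff: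
  assumes "l \<in> Mor A" "x \<in> Mor A" "Dom A x = Cod A l"
  shows "meets_trivially (dual A) x (Coker A l) \<longleftrightarrow>
    (\<forall>v\<in>Mor A. Dom A v = Cod A x \<and> v \<cdot> (x \<cdot> l) = zero (Dom A l) (Cod A v)
       \<longrightarrow> v \<cdot> x = zero (Cod A l) (Cod A v))"
proof -
  have "factors_through (dual A) (v \<cdot> x) (Coker A l) \<longleftrightarrow> v \<cdot> (x \<cdot> l) = zero (Dom A l) (Cod A v)"
    if "v \<in> Mor A" "Dom A v = Cod A x" for v
    using factors_through_Coker_iff[of l "v \<cdot> x"] that assms by simp
  thus ?thesis unfolding meets_trivially_def using assms(3) by auto
qed

lemma epi_factors:
  assumes "is_epi A y" "c \<in> Mor A" "Dom A c = Dom A y" "c \<cdot> Ker A y = zero (Dom A (Ker A y)) (Cod A c)"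
  obtains v where "v \<in> Mor A" "Dom A v = Cod A y" "Cod A v = Cod A c" "v \<cdot> y = c"
proof -
  have "factors_through (dual A) c y"
    using op.factors_through_mono_iff[of y c] assms by simp
  thus ?thesis by (rule op.factors_throughE) (use that in auto)
qed

text \<open>Let \<open>l\<close> lie above the summand \<open>d\<close>, and let \<open>i \<cdot> q\<close> be the projection with kernel \<open>d\<close>. An
  epimorphism \<open>x\<close> with \<open>x \<cdot> i \<cdot> q = x\<close> is a quotient \<open>y\<close> of \<open>M/D\<close>. If \<open>x\<close> meets \<open>Coker l\<close> trivially
  in the opposite category, then the sum of \<open>L/D\<close> and the kernel of \<open>y\<close> is \<open>M/D\<close>; as \<open>L/D\<close> is
  superfluous, the kernel of \<open>y\<close> is everything and \<open>x = 0\<close>.\<close>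

lemma lies_above_summand_imp:
  assumes "is_mono A l" "Cod A l = M" "lies_above_summand A M l"
  shows "essential_split (dual A) M (Coker A l)"
proof -
  have l: "l \<in> Mor A" using assms(1) by (rule mono_Mor)
  obtain d h j Y i p q where dh: "h \<in> Hom A (Dom A d) (Dom A l)" "l \<cdot> h = d"
    "j \<in> Hom A (Cod A (Coker A h)) (Cod A (Coker A d))"
    "j \<cdot> Coker A h = Coker A d \<cdot> l" "superfluous A (Cod A (Coker A d)) j"
    and sum: "is_direct_sum A (Dom A d) Y M d i p q"
    using assms(3) unfolding lies_above_summand_def direct_summand_def by metis
  note s = direct_sumD[OF sum] and c = direct_sum_cmp[OF sum]
  define J where "J = Cod A (Coker A d)"
  have h: "h \<in> Mor A" "Cod A h = Dom A l" "Dom A h = Dom A d" using dh by (auto simp: Hom_iff)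
  have cd: "Coker A d \<in> Mor A" "Dom A (Coker A d) = M" "Cod A (Coker A d) = J"
    "is_epi A (Coker A d)" using s by (simp_all add: J_def)
  have j: "j \<in> Mor A" "Cod A j = J" "Dom A j = Cod A (Coker A h)" "is_mono A j"
    using dh by (auto simp: Hom_iff J_def superfluous_def)
  have sup: "factors_through A (Ide A J) x" if "is_mono A x" "Cod A x = J"
    "factors_through A (Ide A J) (j \<squnion>\<^bsub>Sub A J\<^esub> x)" for x
  proof -
    note jn = join_props[OF j(4,2) that(1,2)]
    have "factors_through A (j \<squnion>\<^bsub>Sub A J\<^esub> x) (Ide A J)"
      by (rule factors_throughI[of _ "j \<squnion>\<^bsub>Sub A J\<^esub> x"]) (use jn mono_Mor cd in auto)
    thus ?thesis using dh(5) that unfolding superfluous_def J_def by simp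
  qed
  have cl: "Coker A l \<in> Mor A" "Dom A (Coker A l) = M" using l assms by simp_all
  have "Coker A l \<cdot> (l \<cdot> h) = zero (Dom A d) (Cod A (Coker A l))"
    using cmp_extend[OF Coker_simps(4)[OF l], of h] l h by simp
  hence cld: "Coker A l \<cdot> d = zero (Dom A d) (Cod A (Coker A l))" using dh(2) by simp
  have cliq: "Coker A l \<cdot> (i \<cdot> q) = Coker A l"
    using c(6)[of "Coker A l"] cmp_extend[OF cld, of p] cl s by simp
  show ?thesis
  proof (rule op.essential_splitI[of "i \<cdot> q"], simp_all only: dual_simps is_mono_dual)
    show "i \<cdot> q \<in> Mor A" "Dom A (i \<cdot> q) = M" "Cod A (i \<cdot> q) = M" using s by simp_all
    show "(i \<cdot> q) \<cdot> (i \<cdot> q) = i \<cdot> q" using s c(2)[of q] by simp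
    show "Coker A l \<cdot> (i \<cdot> q) = Coker A l" by fact
    fix x assume xm: "x \<in> Mor A" and x: "is_epi A x" "Dom A x = M" "x \<cdot> (i \<cdot> q) = x"
      and t: "meets_trivially (dual A) x (Coker A l)"
    have t': "v \<cdot> x = zero M (Cod A v)" if "v \<in> Mor A" "Dom A v = Cod A x"
      "v \<cdot> (x \<cdot> l) = zero (Dom A l) (Cod A v)" for v
      using t that xm x(2) l assms(2) by (simp add: meets_trivially_Coker_iff)
    have "(x \<cdot> (i \<cdot> q)) \<cdot> d = zero (Dom A d) (Cod A x)" using xm x(2) s by simp
    hence xd: "x \<cdot> d = zero (Dom A d) (Cod A x)" unfolding x(3) .
    obtain y where y: "y \<in> Mor A" "Dom A y = J" "Cod A y = Cod A x" "y \<cdot> Coker A d = x"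
      by (rule factors_through_Coker[of d x]) (use xd xm x(2) s cd in auto)
    have ye: "is_epi A y"
      using op.mono_cmpD[of "Coker A d" y] y cd x(1) by simp
    define w where "w = Ker A y"
    have w: "w \<in> Mor A" "is_mono A w" "Cod A w = J" "y \<cdot> w = zero (Dom A w) (Cod A x)"
      using y by (auto simp: w_def)
    define u where "u = j \<squnion>\<^bsub>Sub A J\<^esub> w"
    note u = join_props[OF j(4,2) w(2,3), folded u_def]
    have um: "u \<in> Mor A" using u(1) by (rule mono_Mor)
    \<comment> \<open>To see that the sum \<open>u\<close> is all of \<open>M/D\<close>, show that its cokernel \<open>c'\<close> is zero. It kills the
      kernel of \<open>y\<close>, so it is \<open>v \<cdot> y\<close> for some \<open>v\<close>; it also kills \<open>L/D\<close>, so \<open>v \<cdot> x\<close> kills \<open>l\<close>.\<close>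
    define c' where "c' = Coker A u"
    have c': "c' \<in> Mor A" "Dom A c' = J" using um u(2) by (auto simp: c'_def)
    have c'j: "c' \<cdot> j = zero (Dom A j) (Cod A c')" and c'w: "c' \<cdot> w = zero (Dom A w) (Cod A c')"
      using factors_through_mono_iff[OF u(1), of j] factors_through_mono_iff[OF u(1), of w]
        u(2-4) j w by (auto simp: c'_def)
    obtain v where v: "v \<in> Mor A" "Dom A v = Cod A y" "Cod A v = Cod A c'" "v \<cdot> y = c'"
      by (rule epi_factors[OF ye c'(1)]) (use c' c'w y in \<open>auto simp: w_def\<close>)
    have xl: "x \<cdot> l = y \<cdot> (j \<cdot> Coker A h)"
      unfolding dh(4) using cmp_extend[OF y(4), of l] y cd l assms(2) by simp
    have "v \<cdot> (y \<cdot> (j \<cdot> Coker A h)) = c' \<cdot> (j \<cdot> Coker A h)"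
      by (rule cmp_extend[OF v(4)]) (use v y j h in auto)
    also have "\<dots> = zero (Dom A j) (Cod A c') \<cdot> Coker A h"
      by (rule cmp_extend[OF c'j]) (use c' j h in auto)
    also have "\<dots> = zero (Dom A l) (Cod A v)" using v c' h j by simp
    finally have "v \<cdot> x = zero M (Cod A v)" using v y by (intro t') (auto simp: xl)
    moreover have "v \<cdot> x = c' \<cdot> Coker A d"
      using cmp_extend[OF v(4), of "Coker A d"] y v cd by simp
    ultimately have "c' = zero J (Cod A c')"
      using epi_cancel_zero[OF cd(4) c'(1)] c' cd v by simp
    hence "c' \<cdot> Ide A J = zero J (Cod A c')" using c' by simp
    hence "factors_through A (Ide A J) u"
      using factors_through_mono_iff[OF u(1), of "Ide A J"] u(2) cd(1,3) Cod_in_Obj[OF cd(1)]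
      by (simp add: c'_def)
    hence "factors_through A (Ide A J) w" using sup[OF w(2,3)] by (simp add: u_def)
    hence "y \<cdot> Ide A J = zero J (Cod A y)"
      using factors_through_Ker_iff[of y "Ide A J"] y Cod_in_Obj[OF cd(1)] cd by (simp add: w_def)
    hence "y = zero J (Cod A x)" using y by simp
    hence "x = zero J (Cod A x) \<cdot> Coker A d" using y(4) by simp
    also have "\<dots> = zero M (Cod A x)" using cd xm by simp
    finally show "x = zero M (Cod A x)" .
  qed
qed

text \<open>Let \<open>e = i \<cdot> q\<close> be an idempotent for \<open>Coker l\<close> in the opposite category. Then \<open>l\<close> lies above the
  kernel \<open>d\<close> of \<open>e\<close>: a quotient of \<open>M/D\<close> by a subobject \<open>x\<close> that together with \<open>L/D\<close> generates
  \<open>M/D\<close> is a quotient of \<open>M\<close> fixed by \<open>e\<close> and meeting \<open>Coker l\<close> trivially, so it is zero.\<close>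

lemma lies_above_summandI:
  assumes "is_mono A l" "Cod A l = M" "essential_split (dual A) M (Coker A l)"
  shows "lies_above_summand A M l"
proof -
  have l: "l \<in> Mor A" using assms(1) by (rule mono_Mor)
  have cl: "Coker A l \<in> Mor A" "Dom A (Coker A l) = M" using l assms by simp_all
  obtain e where e: "e \<in> Mor A" "Dom A e = M" "Cod A e = M" "e \<cdot> e = e" "Coker A l \<cdot> e = Coker A l"
    and ess: "\<And>x. \<lbrakk>is_epi A x; Dom A x = M; x \<cdot> e = x; meets_trivially (dual A) x (Coker A l)\<rbrakk>
        \<Longrightarrow> x = zero M (Cod A x)"
    using assms(3) by (rule op.essential_splitE) (simp only: dual_simps is_mono_dual)
  obtain X Y d i p q where sum': "is_direct_sum A Y X M i d q p" and iq: "i \<cdot> q = e"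
    using idempotent_splits e by blast
  have sum: "is_direct_sum A X Y M d i p q" using sum' by (rule direct_sum_swap)
  note s = direct_sumD[OF sum] and c = direct_sum_cmp[OF sum]
  have dm: "is_mono A d" by (rule split_mono[of p]) (use s in auto)
  have "Coker A l \<cdot> d = (Coker A l \<cdot> e) \<cdot> d" using e by simp
  also have "\<dots> = Coker A l \<cdot> (i \<cdot> (q \<cdot> d))" unfolding iq[symmetric] using s cl by simp
  also have "\<dots> = zero X (Cod A (Coker A l))" using s cl by simp
  finally have "factors_through A d l" using factors_through_mono_iff[OF assms(1)] s assms(2) by simp
  then obtain h where h: "h \<in> Mor A" "Dom A h = X" "Cod A h = Dom A l" "l \<cdot> h = d"
    by (rule factors_throughE) (use s in auto)
  define J where "J = Cod A (Coker A d)"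
  have cd: "Coker A d \<in> Mor A" "Dom A (Coker A d) = M" "Cod A (Coker A d) = J"
    "is_epi A (Coker A d)" using s by (simp_all add: J_def)
  have J: "J \<in> Obj A" using cd by auto
  have cdd: "Coker A d \<cdot> d = zero X J" using s J_def by simp
  define H where "H = Cod A (Coker A h)"
  have ch: "Coker A h \<in> Mor A" "Dom A (Coker A h) = Dom A l" "Cod A (Coker A h) = H"
    "is_epi A (Coker A h)" "Coker A h \<cdot> h = zero X H" using h by (simp_all add: H_def)
  have H: "H \<in> Obj A" using ch by auto
  have "(Coker A d \<cdot> l) \<cdot> h = zero X J" using cd cdd l h assms(2) by simp
  then obtain j where j: "j \<in> Mor A" "Dom A j = H" "Cod A j = J" "j \<cdot> Coker A h = Coker A d \<cdot> l"
    using factors_through_Coker[of h "Coker A d \<cdot> l"] cd l h assms(2) by (auto simp: H_def)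
  \<comment> \<open>As \<open>D\<close> is a summand of \<open>M\<close>, it is also one of \<open>L\<close>: \<open>h \<cdot> p \<cdot> l\<close> is an idempotent of \<open>L\<close>, and its
    complement \<open>t\<close> induces a section \<open>z\<close> of \<open>L \<rightarrow> L/D\<close>. If \<open>j\<close> kills \<open>u\<close>, then \<open>l \<cdot> z \<cdot> u\<close> lies in \<open>D\<close>,
    so that \<open>u\<close>, the class of \<open>z \<cdot> u\<close> modulo \<open>D\<close>, is zero.\<close>
  have jm: "is_mono A j"
  proof (rule mono_if_kernel_zero[OF j(1)])
    fix u assume u: "u \<in> Mor A" "Cod A u = Dom A j" "j \<cdot> u = zero (Dom A u) (Cod A j)"
    have pl: "p \<cdot> l \<in> Mor A" "Dom A (p \<cdot> l) = Dom A l" "Cod A (p \<cdot> l) = X" using s l assms by simp_all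
    define r where "r = h \<cdot> (p \<cdot> l)"
    have r: "r \<in> Mor A" "Dom A r = Dom A l" "Cod A r = Dom A l" using h pl by (simp_all add: r_def)
    have rh: "r \<cdot> h = h" unfolding r_def using h pl s l assms by simp
    obtain t where t: "t \<in> Mor A" "Dom A t = Dom A l" "Cod A t = Dom A l"
      "r +\<^bsub>A\<^esub> t = Ide A (Dom A l)"
      using complement_exists[of r "Ide A (Dom A l)"] r l by auto
    have "r \<cdot> h +\<^bsub>A\<^esub> t \<cdot> h = h" using distrib(2)[of r t h] r t h l by simp
    hence "h +\<^bsub>A\<^esub> t \<cdot> h = h +\<^bsub>A\<^esub> zero X (Dom A l)" using rh h by simp
    hence th: "t \<cdot> h = zero X (Dom A l)" by (rule add_cancel) (use h t s l in auto)
    obtain z where z: "z \<in> Mor A" "Dom A z = H" "Cod A z = Dom A l" "z \<cdot> Coker A h = t"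
      using factors_through_Coker[of h t] t h th by (auto simp: H_def)
    have "Coker A h \<cdot> r = zero (Dom A l) H"
      unfolding r_def using cmp_extend[OF ch(5), of "p \<cdot> l"] ch h pl H s by simp
    hence "Coker A h \<cdot> t = Coker A h"
      using distrib(1)[of r t "Coker A h"] r t ch l H by simp
    hence czc: "(Coker A h \<cdot> z) \<cdot> Coker A h = Coker A h"
      using z ch t by simp
    have cz: "Coker A h \<cdot> z = Ide A H"
      by (rule epi_cancel[OF ch(4)]) (use z ch czc H in auto)
    have u2: "Cod A u = H" using u j by simp
    have "Coker A d \<cdot> (l \<cdot> (z \<cdot> u)) = j \<cdot> (Coker A h \<cdot> (z \<cdot> u))"
      using cmp_extend[OF j(4), of "z \<cdot> u"] j ch z u(1) u2 cd l assms(2) by simp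
    also have "\<dots> = zero (Dom A u) J"
      using cmp_extend[OF cz, of u] u(1,3) u2 z ch j by simp
    finally have "factors_through A (l \<cdot> (z \<cdot> u)) d"
      using factors_through_mono_iff[OF dm, of "l \<cdot> (z \<cdot> u)"] l z u(1) u2 s assms(2)
      by (simp add: J_def)
    then obtain y where y: "y \<in> Mor A" "Dom A y = Dom A u" "Cod A y = X" "d \<cdot> y = l \<cdot> (z \<cdot> u)"
      by (rule factors_throughE) (use l z u(1) u2 s in auto)
    have "l \<cdot> (h \<cdot> y) = l \<cdot> (z \<cdot> u)" using cmp_extend[OF h(4), of y] h y l by simp
    hence hy: "h \<cdot> y = z \<cdot> u"
      using mono_cancel[OF assms(1), of "h \<cdot> y" "z \<cdot> u"] h y z u(1) u2 by simp
    have "u = Coker A h \<cdot> (z \<cdot> u)" using cmp_extend[OF cz, of u] u(1) u2 z ch by simp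
    also have "\<dots> = zero (Dom A u) H"
      unfolding hy[symmetric] using cmp_extend[OF ch(5), of y] ch h y H s by simp
    finally show "u = zero (Dom A u) (Dom A j)" using j by simp
  qed
  have "superfluous A J j"
    unfolding superfluous_def
  proof (intro conjI ballI impI)
    show "j \<in> carrier (Sub A J)" using jm j by simp
    fix x assume "x \<in> carrier (Sub A J)" and jx: "(j \<squnion>\<^bsub>Sub A J\<^esub> x) .=\<^bsub>Sub A J\<^esub> Ide A J"
    hence x: "is_mono A x" "Cod A x = J" by auto
    have xm: "x \<in> Mor A" using x(1) by (rule mono_Mor)
    define u where "u = j \<squnion>\<^bsub>Sub A J\<^esub> x"
    note u = join_props[OF jm j(3) x, folded u_def]
    have um: "u \<in> Mor A" using u(1) by (rule mono_Mor)
    have "factors_through A (Ide A J) u" using jx by (simp add: u_def)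
    then obtain b where b: "b \<in> Mor A" "Dom A b = J" "Cod A b = Dom A u" "u \<cdot> b = Ide A J"
      by (rule factors_throughE) (use J in auto)
    define y where "y = Coker A x"
    have y: "y \<in> Mor A" "Dom A y = J" "is_epi A y" "y \<cdot> x = zero (Dom A x) (Cod A y)"
      using xm x by (auto simp: y_def)
    define w where "w = y \<cdot> Coker A d"
    have w: "w \<in> Mor A" "Dom A w = M" "Cod A w = Cod A y" using y cd by (simp_all add: w_def)
    have "w = zero M (Cod A w)"
    proof (rule ess)
      show "is_epi A w" unfolding w_def by (rule epi_cmp) (use cd y in auto)
      show "Dom A w = M" by fact
      have wd: "w \<cdot> d = zero X (Cod A w)" using w y cd cdd s by (simp add: w_def)
      show "w \<cdot> e = w" using c(6)[OF w(1,2)] cmp_extend[OF wd, of p] w s iq e(1-3) y by simp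
      show "meets_trivially (dual A) w (Coker A l)"
        unfolding meets_trivially_Coker_iff[OF l w(1), unfolded assms(2), OF w(2)]
      proof (intro ballI impI; elim conjE)
        fix v assume v: "v \<in> Mor A" "Dom A v = Cod A w" "v \<cdot> (w \<cdot> l) = zero (Dom A l) (Cod A v)"
        have vy: "v \<cdot> y \<in> Mor A" "Dom A (v \<cdot> y) = J" "Cod A (v \<cdot> y) = Cod A v"
          using v(1,2) w y by simp_all
        have "((v \<cdot> y) \<cdot> j) \<cdot> Coker A h = zero (Dom A l) (Cod A v)"
          using v w y j ch cd l assms(2) by (simp add: w_def)
        hence "(v \<cdot> y) \<cdot> j = zero (Dom A j) (Cod A v)"
          using epi_cancel_zero[OF ch(4), of "(v \<cdot> y) \<cdot> j"] vy j ch by simp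
        moreover have "(v \<cdot> y) \<cdot> x = zero (Dom A x) (Cod A v)"
          using v(1,2) w y xm x by simp
        ultimately have vyu: "(v \<cdot> y) \<cdot> u = zero (Dom A u) (Cod A v)"
          using u(5)[of "v \<cdot> y"] vy by simp
        have "v \<cdot> y = (v \<cdot> y) \<cdot> (u \<cdot> b)" using vy b(4) by simp
        also have "\<dots> = zero (Dom A u) (Cod A v) \<cdot> b"
          by (rule cmp_extend[OF vyu]) (use vy um u(2) b in auto)
        also have "\<dots> = zero J (Cod A v)" using b um v(1) by simp
        finally have vy0: "v \<cdot> y = zero J (Cod A v)" .
        have "v \<cdot> w = zero J (Cod A v) \<cdot> Coker A d"
          unfolding w_def by (rule cmp_extend[OF vy0]) (use v(1,2) w y cd in auto)
        thus "v \<cdot> w = zero M (Cod A v)" using cd v(1) by simp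
      qed
    qed
    hence "y = zero J (Cod A y)" using epi_cancel_zero[OF cd(4) y(1)] y cd w by (simp add: w_def)
    hence "y \<cdot> Ide A J = zero J (Cod A y)" using y by simp
    hence "factors_through A (Ide A J) x"
      using factors_through_mono_iff[OF x(1), of "Ide A J"] x J by (simp add: y_def)
    moreover have "factors_through A x (Ide A J)"
      by (rule factors_throughI[of _ x]) (use x xm J in auto)
    ultimately show "x .=\<^bsub>Sub A J\<^esub> Ide A J" by simp
  qed
  moreover have "direct_summand A M d"
    unfolding direct_summand_def using dm s sum by auto
  moreover have "h \<in> Hom A (Dom A d) (Dom A l)" using h s by (simp add: Hom_iff)
  moreover have "j \<in> Hom A (Cod A (Coker A h)) (Cod A (Coker A d))"
    using j ch cd by (simp add: Hom_iff)
  moreover have "l \<in> carrier (Sub A M)" using assms by simp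
  ultimately show ?thesis
    unfolding lies_above_summand_def using h(4)[symmetric] j(4) J_def by blast
qed

lemma lies_above_summand_iff:
  assumes "is_mono A l" "Cod A l = M"
  shows "lies_above_summand A M l \<longleftrightarrow> essential_split (dual A) M (Coker A l)"
  using assms lies_above_summand_imp lies_above_summandI by blast

end


section \<open>Passing from a direct sum with an injective object to its summand\<close>

context abelian_category
begin


text \<open>A direct summand is essential in itself: a subobject that it contains and that meets it trivially
  is zero.\<close>

lemma split_mono_essential_split:
  assumes "d \<in> Mor A" "r \<in> Mor A" "Dom A r = M" "Cod A d = M" "Cod A r = Dom A d"
    "r \<cdot> d = Ide A (Dom A d)"
  shows "essential_split A M d"
proof (rule essential_splitI[of "d \<cdot> r"])
  show "d \<cdot> r \<in> Mor A" "Dom A (d \<cdot> r) = M" "Cod A (d \<cdot> r) = M" using assms by simp_all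
  show "(d \<cdot> r) \<cdot> (d \<cdot> r) = d \<cdot> r" using cmp_extend[OF assms(6), of r] assms by simp
  show "(d \<cdot> r) \<cdot> d = d" using assms by simp
  fix x assume x: "x \<in> Mor A" "Cod A x = M" "(d \<cdot> r) \<cdot> x = x" "meets_trivially A x d"
  have X: "Dom A x \<in> Obj A" using x by simp
  have "d \<cdot> (r \<cdot> x) = x" using x(1-3) assms by simp
  hence "factors_through A x d" by (rule factors_throughI) (use x(1,2) assms in auto)
  hence "x \<cdot> Ide A (Dom A x) = zero (Dom A (Ide A (Dom A x))) (Cod A x)"
    using x X by (intro meets_triviallyD) auto
  thus "x = zero (Dom A x) M" using x X by simp
qed

text \<open>Embed the cokernel of \<open>k\<close> into an injective object.\<close>

lemma mono_is_kernel_to_injective: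
  assumes "enough_injectives A" "is_mono A k"
  obtains f where "f \<in> Mor A" "Dom A f = Cod A k" "injective_object A (Cod A f)"
    "f \<cdot> k = zero (Dom A k) (Cod A f)"
    "\<And>g. \<lbrakk>g \<in> Mor A; Cod A g = Cod A k; f \<cdot> g = zero (Dom A g) (Cod A f)\<rbrakk> \<Longrightarrow> factors_through A g k"
proof -
  have k: "k \<in> Mor A" using assms(2) by (rule mono_Mor)
  define c where "c = Coker A k"
  have c: "c \<in> Mor A" "Dom A c = Cod A k" "c \<cdot> k = zero (Dom A k) (Cod A c)"
    using k by (simp_all add: c_def)
  obtain E n where n: "injective_object A E" "n \<in> Mor A" "Dom A n = Cod A c" "Cod A n = E" "is_mono A n"
    using assms(1) c Cod_in_Obj[OF c(1)] unfolding enough_injectives_def Hom_iff by metis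
  show ?thesis
  proof (rule that[of "n \<cdot> c"])
    show "n \<cdot> c \<in> Mor A" "Dom A (n \<cdot> c) = Cod A k" "injective_object A (Cod A (n \<cdot> c))"
      "(n \<cdot> c) \<cdot> k = zero (Dom A k) (Cod A (n \<cdot> c))"
      using n c k by simp_all
    fix g assume g: "g \<in> Mor A" "Cod A g = Cod A k" "(n \<cdot> c) \<cdot> g = zero (Dom A g) (Cod A (n \<cdot> c))"
    have "n \<cdot> (c \<cdot> g) = zero (Dom A g) (Cod A n)" using g n c by simp
    hence "c \<cdot> g = zero (Dom A g) (Cod A c)"
      using mono_cancel_zero[OF n(5), of "c \<cdot> g"] g(1,2) n c by simp
    thus "factors_through A g k"
      using factors_through_mono_iff[OF assms(2) g(1,2)] by (simp add: c_def)
  qed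
qed

lemma direct_sum_in_class:
  assumes "closed_under_direct_sums A \<C>" "X \<in> \<C>" "Y \<in> \<C>"
  obtains S i j p q where "S \<in> \<C>" "is_direct_sum A X Y S i j p q"
  using assms unfolding closed_under_direct_sums_def by blast

text \<open>The kernel of \<open>j \<cdot> f \<cdot> p\<close> is \<open>K \<oplus> E\<close>. If \<open>e\<close> is an idempotent of \<open>M \<oplus> E\<close> whose image \<open>D\<close> contains
  it as an essential subobject, then \<open>D\<close> contains \<open>E\<close>, so that \<open>D\<close> is the direct sum of its
  intersection with \<open>M\<close> and \<open>E\<close>. The idempotent \<open>p \<cdot> e \<cdot> i\<close> projects \<open>M\<close> onto this intersection, in
  which \<open>K\<close> is essential since \<open>K \<oplus> E\<close> meets \<open>M\<close> in \<open>K\<close>.\<close>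

lemma essential_split_if_kernel:
  assumes f: "f \<in> Mor A" "Dom A f = M" "Cod A f = E"
    and k: "is_mono A k" "Cod A k = M" "f \<cdot> k = zero (Dom A k) E"
    and kf: "\<And>g. \<lbrakk>g \<in> Mor A; Cod A g = M; f \<cdot> g = zero (Dom A g) E\<rbrakk> \<Longrightarrow> factors_through A g k"
    and sum: "is_direct_sum A M E S i j p q"
    and ker: "essential_split A S (Ker A (j \<cdot> (f \<cdot> p)))"
  shows "essential_split A M k"
proof -
  note s = direct_sumD[OF sum] and c = direct_sum_cmp[OF sum]
  have km: "k \<in> Mor A" using k(1) by (rule mono_Mor)
  define F where "F = j \<cdot> (f \<cdot> p)"
  have F: "F \<in> Mor A" "Dom A F = S" "Cod A F = S" using s f by (simp_all add: F_def)
  obtain e where e: "e \<in> Mor A" "Dom A e = S" "Cod A e = S" "e \<cdot> e = e" "e \<cdot> Ker A F = Ker A F"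
    and ess: "\<And>x. \<lbrakk>is_mono A x; Cod A x = S; e \<cdot> x = x; meets_trivially A x (Ker A F)\<rbrakk>
        \<Longrightarrow> x = zero (Dom A x) S"
    using ker[folded F_def] by (rule essential_splitE) blast
  have fix_e: "e \<cdot> g = g" if g: "g \<in> Mor A" "Cod A g = S" "F \<cdot> g = zero (Dom A g) S" for g
  proof -
    have "factors_through A g (Ker A F)" using g F by (simp add: factors_through_Ker_iff)
    then obtain t where t: "t \<in> Mor A" "Cod A t = Dom A (Ker A F)" "Ker A F \<cdot> t = g"
      by (rule factors_throughE)
    show ?thesis using cmp_extend[OF e(5), of t] e(1-3) F t by simp
  qed
  have ej: "e \<cdot> j = j" by (rule fix_e) (use s f in \<open>simp_all add: F_def\<close>)
  have eik: "e \<cdot> (i \<cdot> k) = i \<cdot> k"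
    by (rule fix_e) (use s f k km c(1)[OF km k(2)] in \<open>simp_all add: F_def\<close>)
  have pej: "p \<cdot> (e \<cdot> (j \<cdot> t)) = zero (Dom A t) M" if "t \<in> Mor A" "Cod A t = E" for t
    using cmp_extend[OF ej, of t] c(3)[OF that] that s e(1-3) by simp
  have split: "i \<cdot> (p \<cdot> (e \<cdot> t)) +\<^bsub>A\<^esub> j \<cdot> (q \<cdot> (e \<cdot> t)) = e \<cdot> t" if "t \<in> Mor A" "Cod A t = S" for t
    using c(5)[of "e \<cdot> t"] that e(1-3) by simp
  have ee: "e \<cdot> (e \<cdot> t) = e \<cdot> t" if "t \<in> Mor A" "Cod A t = S" for t
    using cmp_extend[OF e(4), of t] that e(1-3) by simp
  show ?thesis
  proof (rule essential_splitI[of "p \<cdot> (e \<cdot> i)"])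
    show "p \<cdot> (e \<cdot> i) \<in> Mor A" "Dom A (p \<cdot> (e \<cdot> i)) = M" "Cod A (p \<cdot> (e \<cdot> i)) = M"
      using s e(1-3) by simp_all
    have "p \<cdot> (e \<cdot> (i \<cdot> (p \<cdot> (e \<cdot> i)) +\<^bsub>A\<^esub> j \<cdot> (q \<cdot> (e \<cdot> i)))) = p \<cdot> (e \<cdot> i)"
      using split[of i] ee[of i] s by simp
    thus "(p \<cdot> (e \<cdot> i)) \<cdot> (p \<cdot> (e \<cdot> i)) = p \<cdot> (e \<cdot> i)"
      using pej[of "q \<cdot> (e \<cdot> i)"] s e(1-3) by simp
    show "(p \<cdot> (e \<cdot> i)) \<cdot> k = k"
      using eik c(1)[OF km k(2)] s e(1-3) km k(2) by simp
    fix x assume x: "x \<in> Mor A" "is_mono A x" "Cod A x = M" "(p \<cdot> (e \<cdot> i)) \<cdot> x = x"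
      "meets_trivially A x k"
    have px: "p \<cdot> (e \<cdot> (i \<cdot> x)) = x" using x(1,3,4) s e(1-3) by simp
    \<comment> \<open>The \<open>M\<close>-component of \<open>e \<cdot> i \<cdot> x\<close> is \<open>x\<close>; its \<open>E\<close>-component \<open>y\<close> is fixed by \<open>e\<close> and hence zero,
      as one sees on applying \<open>e\<close> to \<open>e \<cdot> i \<cdot> x = i \<cdot> x + y\<close>.\<close>
    define y where "y = j \<cdot> (q \<cdot> (e \<cdot> (i \<cdot> x)))"
    have y: "y \<in> Mor A" "Dom A y = Dom A x" "Cod A y = S" using x(1,3) s e(1-3) by (simp_all add: y_def)
    have ix: "i \<cdot> x \<in> Mor A" "Dom A (i \<cdot> x) = Dom A x" "Cod A (i \<cdot> x) = S" using x(1,3) s by simp_all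
    have eix: "i \<cdot> x +\<^bsub>A\<^esub> y = e \<cdot> (i \<cdot> x)" using split[of "i \<cdot> x"] ix px by (simp add: y_def)
    have ey: "e \<cdot> y = y"
      unfolding y_def using cmp_extend[OF ej, of "q \<cdot> (e \<cdot> (i \<cdot> x))"] s e(1-3) x(1,3) by simp
    have "e \<cdot> (i \<cdot> x +\<^bsub>A\<^esub> y) = e \<cdot> (i \<cdot> x) +\<^bsub>A\<^esub> e \<cdot> y"
      by (rule distrib(1)) (use ix y e(1-3) in simp_all)
    hence "e \<cdot> (i \<cdot> x) +\<^bsub>A\<^esub> e \<cdot> y = e \<cdot> (e \<cdot> (i \<cdot> x))"
      unfolding eix by (rule sym)
    hence "e \<cdot> (i \<cdot> x) +\<^bsub>A\<^esub> y = e \<cdot> (i \<cdot> x) +\<^bsub>A\<^esub> zero (Dom A x) S"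
      using ee[of "i \<cdot> x"] ix ey e(1-3) by simp
    hence "y = zero (Dom A x) S" by (rule add_cancel) (use ix y e(1-3) s x(1) in auto)
    hence fixed: "e \<cdot> (i \<cdot> x) = i \<cdot> x" using eix ix by simp
    have im: "is_mono A i" by (rule split_mono[of p]) (use s in auto)
    have "i \<cdot> x = zero (Dom A (i \<cdot> x)) S"
    proof (rule ess)
      show "is_mono A (i \<cdot> x)" by (rule mono_cmp) (use x im s in auto)
      show "meets_trivially A (i \<cdot> x) (Ker A F)"
      proof (rule meets_triviallyI)
        fix v assume v: "v \<in> Mor A" "Cod A v = Dom A (i \<cdot> x)" "factors_through A ((i \<cdot> x) \<cdot> v) (Ker A F)"
        have v2: "Cod A v = Dom A x" using v(2) ix by simp
        have xv: "x \<cdot> v \<in> Mor A" "Cod A (x \<cdot> v) = M" "Dom A (x \<cdot> v) = Dom A v"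
          using v(1) v2 x(1,3) by simp_all
        have "F \<cdot> (i \<cdot> (x \<cdot> v)) = zero (Dom A v) S"
          using factors_through_Ker_iff[of F "i \<cdot> (x \<cdot> v)"] v(1,3) v2 F s x(1,3) by simp
        hence "j \<cdot> (f \<cdot> (x \<cdot> v)) = zero (Dom A v) S"
          unfolding F_def using c(1)[of "x \<cdot> v"] xv s f by simp
        moreover have "f \<cdot> (x \<cdot> v) = q \<cdot> (j \<cdot> (f \<cdot> (x \<cdot> v)))"
          using c(2)[of "f \<cdot> (x \<cdot> v)"] xv f by simp
        ultimately have "f \<cdot> (x \<cdot> v) = zero (Dom A v) E" using s v(1) by simp
        hence "factors_through A (x \<cdot> v) k" using kf[of "x \<cdot> v"] xv by simp
        hence "x \<cdot> v = zero (Dom A v) M" using meets_triviallyD[OF x(5) v(1) v2] x(3) by simp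
        thus "(i \<cdot> x) \<cdot> v = zero (Dom A v) (Cod A (i \<cdot> x))" using v(1) v2 x(1,3) s by simp
      qed
    qed (use ix fixed in auto)
    thus "x = zero (Dom A x) M" using mono_cancel_zero[OF im x(1)] ix x(3) s by simp
  qed
qed

text \<open>The intersection \<open>m\<close> of \<open>M\<close> with the graph \<open>i + j \<cdot> f\<close> of \<open>f\<close> is \<open>i \<cdot> k\<close>. If it is essential in the
  image \<open>d: D \<rightarrow> S\<close> of an idempotent, then \<open>D\<close> need not lie in \<open>M\<close>, but \<open>p \<cdot> d\<close> embeds it into \<open>M\<close> as
  a direct summand. This is where injectivity of \<open>E\<close> enters beyond the existence of \<open>f\<close>.\<close>

lemma essential_split_if_meet:
  assumes f: "f \<in> Mor A" "Dom A f = M" "Cod A f = E"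
    and k: "is_mono A k" "Cod A k = M" "f \<cdot> k = zero (Dom A k) E"
    and kf: "\<And>g. \<lbrakk>g \<in> Mor A; Cod A g = M; f \<cdot> g = zero (Dom A g) E\<rbrakk> \<Longrightarrow> factors_through A g k"
    and E: "injective_object A E"
    and sum: "is_direct_sum A M E S i j p q"
    and meet: "essential_split A S (i \<sqinter>\<^bsub>Sub A S\<^esub> (i +\<^bsub>A\<^esub> j \<cdot> f))"
  shows "essential_split A M k"
proof -
  note s = direct_sumD[OF sum] and c = direct_sum_cmp[OF sum]
  have km: "k \<in> Mor A" using k(1) by (rule mono_Mor)
  define \<gamma> where "\<gamma> = i +\<^bsub>A\<^esub> j \<cdot> f"
  have jf: "j \<cdot> f \<in> Mor A" "Dom A (j \<cdot> f) = M" "Cod A (j \<cdot> f) = S" using s f by simp_all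
  have \<gamma>: "\<gamma> \<in> Mor A" "Dom A \<gamma> = M" "Cod A \<gamma> = S" using jf s by (simp_all add: \<gamma>_def)
  have \<gamma>t: "\<gamma> \<cdot> t = i \<cdot> t +\<^bsub>A\<^esub> j \<cdot> (f \<cdot> t)" if "t \<in> Mor A" "Cod A t = M" for t
    unfolding \<gamma>_def using that jf s f by simp
  have p\<gamma>: "p \<cdot> \<gamma> = Ide A M"
    unfolding \<gamma>_def using distrib(1)[of i "j \<cdot> f" p] c(3)[of f] jf s f by simp
  have im: "is_mono A i" by (rule split_mono[of p]) (use s in auto)
  have \<gamma>m: "is_mono A \<gamma>" by (rule split_mono[of p]) (use s \<gamma> p\<gamma> in auto)
  define m where "m = i \<sqinter>\<^bsub>Sub A S\<^esub> \<gamma>"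
  note m = meet_props[OF im s(3) \<gamma>m \<gamma>(3), folded m_def]
  have mm: "m \<in> Mor A" using m(1) by (rule mono_Mor)
  obtain e where e: "e \<in> Mor A" "Dom A e = S" "Cod A e = S" "e \<cdot> e = e" "e \<cdot> m = m"
    and ess: "\<And>x. \<lbrakk>is_mono A x; Cod A x = S; e \<cdot> x = x; meets_trivially A x m\<rbrakk>
        \<Longrightarrow> x = zero (Dom A x) S"
    using meet[folded \<gamma>_def, folded m_def] by (rule essential_splitE) blast
  have through_m: "\<exists>t\<in>Mor A. Cod A t = Dom A k \<and> Dom A t = Dom A g \<and> i \<cdot> (k \<cdot> t) = g"
    if g: "g \<in> Mor A" "factors_through A g m" for g
  proof -
    obtain a where a: "a \<in> Mor A" "Dom A a = Dom A g" "Cod A a = M" "i \<cdot> a = g"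
      using factors_through_trans[OF g(2) m(3) s(1)] by (rule factors_throughE) (use s in auto)
    obtain b where b: "b \<in> Mor A" "Dom A b = Dom A g" "Cod A b = M" "\<gamma> \<cdot> b = g"
      using factors_through_trans[OF g(2) m(4) \<gamma>(1)] by (rule factors_throughE) (use \<gamma> in auto)
    have eq: "i \<cdot> a = i \<cdot> b +\<^bsub>A\<^esub> j \<cdot> (f \<cdot> b)" using a(4) b(4) \<gamma>t[OF b(1,3)] by simp
    have "p \<cdot> (i \<cdot> a) = p \<cdot> (i \<cdot> b +\<^bsub>A\<^esub> j \<cdot> (f \<cdot> b))" using eq by simp
    hence "a = b" using c(1)[OF a(1,3)] c(1)[OF b(1,3)] c(3)[of "f \<cdot> b"] a(1-3) b(1-3) s f by simp
    have "q \<cdot> (i \<cdot> a) = q \<cdot> (i \<cdot> b +\<^bsub>A\<^esub> j \<cdot> (f \<cdot> b))" using eq by simp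
    hence "f \<cdot> b = zero (Dom A b) E"
      using c(4)[OF a(1,3)] c(4)[OF b(1,3)] c(2)[of "f \<cdot> b"] a(1-3) b(1-3) s f by simp
    hence "factors_through A b k" using kf b by simp
    then obtain t where "t \<in> Mor A" "Dom A t = Dom A b" "Cod A t = Dom A k" "k \<cdot> t = b"
      by (rule factors_throughE)
    thus ?thesis using a b \<open>a = b\<close> by auto
  qed
  have "\<gamma> \<cdot> k = i \<cdot> k" using \<gamma>t[OF km k(2)] k(3) km s k(2) by simp
  hence "factors_through A (i \<cdot> k) \<gamma>" by (rule factors_throughI) (use \<gamma> km k in auto)
  moreover have "factors_through A (i \<cdot> k) i" by (rule factors_throughI[of _ k]) (use s km k in auto)
  ultimately have "factors_through A (i \<cdot> k) m" using m(5)[of "i \<cdot> k"] s km k(2) by simp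
  then obtain t where t: "t \<in> Mor A" "Cod A t = Dom A m" "m \<cdot> t = i \<cdot> k"
    by (rule factors_throughE)
  have eik: "e \<cdot> (i \<cdot> k) = i \<cdot> k" using cmp_extend[OF e(5), of t] t mm m(2) e(1-3) by simp
  obtain D Y d w \<pi> r' where sumD: "is_direct_sum A D Y S d w \<pi> r'" and d\<pi>: "d \<cdot> \<pi> = e"
    using idempotent_splits e by blast
  note t = direct_sumD[OF sumD]
  have \<pi>d: "\<pi> \<cdot> (d \<cdot> x) = x" if "x \<in> Mor A" "Cod A x = D" for x
    using direct_sum_cmp(1)[OF sumD that] .
  have dm: "is_mono A d" by (rule split_mono[of \<pi>]) (use t in auto)
  have ed: "e \<cdot> d = d" unfolding d\<pi>[symmetric] using t by simp
  define g where "g = q \<cdot> d"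
  define h where "h = \<pi> \<cdot> j"
  have g: "g \<in> Mor A" "Dom A g = D" "Cod A g = E" using s t by (simp_all add: g_def)
  have h: "h \<in> Mor A" "Dom A h = E" "Cod A h = D" using s t by (simp_all add: h_def)
  have gkills: "g \<cdot> v = zero (Dom A v) E" if v: "v \<in> Mor A" "Cod A v = D" "factors_through A (d \<cdot> v) m" for v
  proof -
    obtain u where u: "u \<in> Mor A" "Cod A u = Dom A k" "Dom A u = Dom A v" "i \<cdot> (k \<cdot> u) = d \<cdot> v"
      using through_m[of "d \<cdot> v"] v t by auto
    have "g \<cdot> v = q \<cdot> (i \<cdot> (k \<cdot> u))" unfolding u(4) g_def using v t s by simp
    thus ?thesis using c(4)[of "k \<cdot> u"] u km k(2) by simp
  qed
  \<comment> \<open>Next, \<open>a = 1 - g \<cdot> h\<close> is a monomorphism. On its kernel \<open>x\<close> one has \<open>g \<cdot> h \<cdot> x = x\<close>; hence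
    \<open>h \<cdot> x\<close> is a subobject of \<open>D\<close>, and as \<open>g\<close> kills \<open>K\<close> it meets \<open>K\<close> trivially.\<close>
  define b where "b = g \<cdot> h"
  have b: "b \<in> Mor A" "Dom A b = E" "Cod A b = E" using g h by (simp_all add: b_def)
  obtain a where a: "a \<in> Mor A" "Dom A a = E" "Cod A a = E" "b +\<^bsub>A\<^esub> a = Ide A E"
    using complement_exists[of b "Ide A E"] b s(14) by auto
  have ab: "b \<cdot> x +\<^bsub>A\<^esub> a \<cdot> x = x" if "x \<in> Mor A" "Cod A x = E" for x
    using distrib(2)[of b a x] that a b by simp
  define x where "x = Ker A a"
  have x: "x \<in> Mor A" "Cod A x = E" "is_mono A x" "a \<cdot> x = zero (Dom A x) E"
    using a by (simp_all add: x_def)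
  have bx: "g \<cdot> (h \<cdot> x) = x" using ab[OF x(1,2)] x g h b by (simp add: b_def)
  have hx: "h \<cdot> x \<in> Mor A" "Dom A (h \<cdot> x) = Dom A x" "Cod A (h \<cdot> x) = D" using h x by simp_all
  have "is_mono A (h \<cdot> x)" by (rule mono_cmpD[of g]) (use bx x g h in auto)
  hence dhxm: "is_mono A (d \<cdot> (h \<cdot> x))" by (rule mono_cmp) (use dm hx t in auto)
  have "d \<cdot> (h \<cdot> x) = zero (Dom A (d \<cdot> (h \<cdot> x))) S"
  proof (rule ess[OF dhxm])
    show "Cod A (d \<cdot> (h \<cdot> x)) = S" using hx t by simp
    show "e \<cdot> (d \<cdot> (h \<cdot> x)) = d \<cdot> (h \<cdot> x)"
      by (rule cmp_extend[OF ed]) (use e t hx in auto)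
    show "meets_trivially A (d \<cdot> (h \<cdot> x)) m"
    proof (rule meets_triviallyI)
      fix v assume v: "v \<in> Mor A" "Cod A v = Dom A (d \<cdot> (h \<cdot> x))"
        "factors_through A ((d \<cdot> (h \<cdot> x)) \<cdot> v) m"
      have v2: "Cod A v = Dom A x" using v(2) hx t by simp
      have hxv: "h \<cdot> (x \<cdot> v) \<in> Mor A" "Cod A (h \<cdot> (x \<cdot> v)) = D" "Dom A (h \<cdot> (x \<cdot> v)) = Dom A v"
        using v(1) v2 h x by simp_all
      have "g \<cdot> (h \<cdot> (x \<cdot> v)) = zero (Dom A v) E"
        using gkills[of "h \<cdot> (x \<cdot> v)"] hxv v(1,3) v2 h x t by simp
      moreover have "g \<cdot> (h \<cdot> (x \<cdot> v)) = x \<cdot> v"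
        using cmp_extend[OF bx, of v] v(1) v2 g h x by simp
      ultimately have "x \<cdot> v = zero (Dom A v) E" by simp
      thus "(d \<cdot> (h \<cdot> x)) \<cdot> v = zero (Dom A v) (Cod A (d \<cdot> (h \<cdot> x)))"
        using v(1) v2 h x t by simp
    qed
  qed
  hence "h \<cdot> x = zero (Dom A x) D" using mono_cancel_zero[OF dm hx(1)] hx t by simp
  hence "x = zero (Dom A x) E" using bx g x by simp
  have am: "is_mono A a"
  proof (rule mono_if_kernel_zero[OF a(1)])
    fix z assume z: "z \<in> Mor A" "Cod A z = Dom A a" "a \<cdot> z = zero (Dom A z) (Cod A a)"
    hence "factors_through A z x" using a by (simp add: x_def factors_through_Ker_iff)
    then obtain z' where z': "z' \<in> Mor A" "Dom A z' = Dom A z" "Cod A z' = Dom A x" "x \<cdot> z' = z"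
      by (rule factors_throughE)
    have "zero (Dom A x) E \<cdot> z' = z" using z'(4) \<open>x = zero (Dom A x) E\<close> by simp
    thus "z = zero (Dom A z) (Dom A a)" using z' a s by simp
  qed
  obtain r where r: "r \<in> Mor A" "Dom A r = E" "Cod A r = E" "r \<cdot> a = Ide A E"
  proof -
    have "Ide A E \<in> Hom A (Dom A a) E" using a s by (simp add: Hom_iff)
    then obtain r where "r \<in> Hom A (Cod A a) E" "r \<cdot> a = Ide A E"
      using E am unfolding injective_object_def by blast
    thus ?thesis using that a by (auto simp: Hom_iff)
  qed
  \<comment> \<open>If \<open>r\<close> is a left inverse of \<open>1 - g \<cdot> h\<close>, then \<open>\<sigma> = 1 + h \<cdot> r \<cdot> g\<close> is one of \<open>\<alpha> = 1 - h \<cdot> g\<close>,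
    because \<open>g \<cdot> \<alpha> = a \<cdot> g\<close>.\<close>
  define \<alpha> where "\<alpha> = \<pi> \<cdot> (i \<cdot> (p \<cdot> d))"
  have \<alpha>: "\<alpha> \<in> Mor A" "Dom A \<alpha> = D" "Cod A \<alpha> = D" using s t by (simp_all add: \<alpha>_def)
  have "\<pi> \<cdot> (i \<cdot> (p \<cdot> d) +\<^bsub>A\<^esub> j \<cdot> (q \<cdot> d)) = \<pi> \<cdot> d" using c(5)[of d] t by simp
  hence \<alpha>hg: "\<alpha> +\<^bsub>A\<^esub> h \<cdot> g = Ide A D" using s t by (simp add: \<alpha>_def g_def h_def)
  have "g \<cdot> (\<alpha> +\<^bsub>A\<^esub> h \<cdot> g) = g \<cdot> \<alpha> +\<^bsub>A\<^esub> g \<cdot> (h \<cdot> g)"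
    by (rule distrib(1)) (use \<alpha> g h in simp_all)
  hence "g \<cdot> \<alpha> +\<^bsub>A\<^esub> g \<cdot> (h \<cdot> g) = g"
    unfolding \<alpha>hg using g by simp
  moreover have "g \<cdot> \<alpha> +\<^bsub>A\<^esub> g \<cdot> (h \<cdot> g) = g \<cdot> (h \<cdot> g) +\<^bsub>A\<^esub> g \<cdot> \<alpha>"
    by (rule add_comm) (use \<alpha> g h in simp_all)
  moreover have "g \<cdot> (h \<cdot> g) +\<^bsub>A\<^esub> a \<cdot> g = g"
    using ab[of g] g h by (simp add: b_def)
  ultimately have "g \<cdot> (h \<cdot> g) +\<^bsub>A\<^esub> g \<cdot> \<alpha> = g \<cdot> (h \<cdot> g) +\<^bsub>A\<^esub> a \<cdot> g" by simp
  hence g\<alpha>: "g \<cdot> \<alpha> = a \<cdot> g" by (rule add_cancel) (use a \<alpha> g h in auto)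
  define \<beta> where "\<beta> = h \<cdot> (r \<cdot> g)"
  have \<beta>: "\<beta> \<in> Mor A" "Dom A \<beta> = D" "Cod A \<beta> = D" using h r g by (simp_all add: \<beta>_def)
  define \<sigma> where "\<sigma> = Ide A D +\<^bsub>A\<^esub> \<beta>"
  have \<sigma>: "\<sigma> \<in> Mor A" "Dom A \<sigma> = D" "Cod A \<sigma> = D" using \<beta> t by (simp_all add: \<sigma>_def)
  have "\<beta> \<cdot> \<alpha> = h \<cdot> g"
    unfolding \<beta>_def using g\<alpha> cmp_extend[OF r(4), of g] a \<alpha> g h r by simp
  hence \<sigma>\<alpha>: "\<sigma> \<cdot> \<alpha> = Ide A D"
    using distrib(2)[of "Ide A D" \<beta> \<alpha>] \<alpha>hg \<alpha> \<beta> t by (simp add: \<sigma>_def)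
  \<comment> \<open>So \<open>\<rho> = \<sigma> \<cdot> \<pi> \<cdot> i\<close> is a retraction of \<open>D' = p \<cdot> d\<close>, and \<open>D' \<cdot> \<rho>\<close> is the idempotent sought.\<close>
  define D' where "D' = p \<cdot> d"
  define \<rho> where "\<rho> = \<sigma> \<cdot> (\<pi> \<cdot> i)"
  have D': "D' \<in> Mor A" "Dom A D' = D" "Cod A D' = M" using s t by (simp_all add: D'_def)
  have \<rho>: "\<rho> \<in> Mor A" "Dom A \<rho> = M" "Cod A \<rho> = D" using s t \<sigma> by (simp_all add: \<rho>_def)
  have \<rho>D: "\<rho> \<cdot> D' = Ide A D"
    using \<sigma>\<alpha> s t \<sigma> by (simp add: \<rho>_def D'_def \<alpha>_def)
  have D'm: "is_mono A D'" by (rule split_mono[of \<rho>]) (use \<rho>D D' \<rho> in auto)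
  define \<kappa> where "\<kappa> = \<pi> \<cdot> (i \<cdot> k)"
  have \<kappa>: "\<kappa> \<in> Mor A" "Dom A \<kappa> = Dom A k" "Cod A \<kappa> = D" using s t km k(2) by (simp_all add: \<kappa>_def)
  have "d \<cdot> \<kappa> = i \<cdot> k"
    unfolding \<kappa>_def using cmp_extend[OF d\<pi>, of "i \<cdot> k"] eik s t km k(2) by simp
  hence D'\<kappa>: "D' \<cdot> \<kappa> = k" unfolding D'_def using c(1)[OF km k(2)] s t \<kappa> by simp
  have \<rho>k: "\<rho> \<cdot> k = \<kappa>"
    using cmp_extend[OF \<rho>D, of \<kappa>] D'\<kappa> \<kappa> D' \<rho> by simp
  show ?thesis
  proof (rule essential_splitI[of "D' \<cdot> \<rho>"])
    show "D' \<cdot> \<rho> \<in> Mor A" "Dom A (D' \<cdot> \<rho>) = M" "Cod A (D' \<cdot> \<rho>) = M" using D' \<rho> by simp_all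
    show "(D' \<cdot> \<rho>) \<cdot> (D' \<cdot> \<rho>) = D' \<cdot> \<rho>"
      using cmp_extend[OF \<rho>D, of \<rho>] D' \<rho> by simp
    show "(D' \<cdot> \<rho>) \<cdot> k = k" using \<rho>k D'\<kappa> D' \<rho> km k(2) by simp
    fix z assume z: "z \<in> Mor A" "is_mono A z" "Cod A z = M" "(D' \<cdot> \<rho>) \<cdot> z = z"
      "meets_trivially A z k"
    define y where "y = \<rho> \<cdot> z"
    have y: "y \<in> Mor A" "Dom A y = Dom A z" "Cod A y = D" using z(1,3) \<rho> by (simp_all add: y_def)
    have D'y: "D' \<cdot> y = z" unfolding y_def using z(1,3,4) D' \<rho> by simp
    have ym: "is_mono A y" by (rule mono_cmpD[of D']) (use D'y z y D' in auto)
    have "d \<cdot> y = zero (Dom A (d \<cdot> y)) S"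
    proof (rule ess)
      show "is_mono A (d \<cdot> y)" by (rule mono_cmp) (use ym dm y t in auto)
      show "Cod A (d \<cdot> y) = S" using y t by simp
      show "e \<cdot> (d \<cdot> y) = d \<cdot> y" by (rule cmp_extend[OF ed]) (use e t y in auto)
      show "meets_trivially A (d \<cdot> y) m"
      proof (rule meets_triviallyI)
        fix v assume v: "v \<in> Mor A" "Cod A v = Dom A (d \<cdot> y)" "factors_through A ((d \<cdot> y) \<cdot> v) m"
        have v2: "Cod A v = Dom A y" using v(2) y t by simp
        obtain u where u: "u \<in> Mor A" "Cod A u = Dom A k" "Dom A u = Dom A v"
          "i \<cdot> (k \<cdot> u) = d \<cdot> (y \<cdot> v)"
          using through_m[of "d \<cdot> (y \<cdot> v)"] v(1,3) v2 y t by auto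
        have "k \<cdot> u = p \<cdot> (i \<cdot> (k \<cdot> u))" using c(1)[of "k \<cdot> u"] u km k(2) by simp
        also have "\<dots> = D' \<cdot> (y \<cdot> v)" unfolding u(4) D'_def using v(1) v2 y t s by simp
        also have "\<dots> = z \<cdot> v" using cmp_extend[OF D'y, of v] v(1) v2 y D' by simp
        finally have "factors_through A (z \<cdot> v) k" by (rule factors_throughI) (use u km in auto)
        hence zv: "z \<cdot> v = zero (Dom A v) M"
          using meets_triviallyD[OF z(5) v(1)] v2 y z(3) by simp
        have "y \<cdot> v = zero (Dom A v) D"
          unfolding y_def using zv v(1) v2 y z(1,3) \<rho> by simp
        thus "(d \<cdot> y) \<cdot> v = zero (Dom A v) (Cod A (d \<cdot> y))" using v(1) v2 y t by simp
      qed
    qed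
    hence "y = zero (Dom A z) D" using mono_cancel_zero[OF dm y(1)] y t by simp
    thus "z = zero (Dom A z) M" using D'y D' z(1) by simp
  qed
qed

end


section \<open>The equivalences and their duals\<close>

context abelian_category
begin

interpretation op: abelian_category "dual A"
  by (rule abelian_category_op)

lemma essential_split_cong:
  assumes "k \<in> Mor A" "k' \<in> Mor A" "Cod A k = M" "Cod A k' = M"
    "factors_through A k k'" "factors_through A k' k"
  shows "essential_split A M k \<longleftrightarrow> essential_split A M k'"
proof -
  have "essential_split A M k'" if asm: "essential_split A M k" "k \<in> Mor A" "k' \<in> Mor A"
    "Cod A k = M" "factors_through A k k'" "factors_through A k' k" for k k'
  proof -
    obtain e where e: "e \<in> Mor A" "Dom A e = M" "Cod A e = M" "e \<cdot> e = e" "e \<cdot> k = k"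
      and ess: "\<And>x. \<lbrakk>is_mono A x; Cod A x = M; e \<cdot> x = x; meets_trivially A x k\<rbrakk>
        \<Longrightarrow> x = zero (Dom A x) M"
      using asm(1) by (rule essential_splitE) blast
    obtain t where t: "t \<in> Mor A" "Cod A t = Dom A k" "k \<cdot> t = k'"
      using asm(6) by (rule factors_throughE)
    have ek': "e \<cdot> k' = k'" using cmp_extend[OF e(5), of t] t e(1-3) asm(2,4) by simp
    have mt: "meets_trivially A x k' \<Longrightarrow> meets_trivially A x k" for x
      unfolding meets_trivially_def using factors_through_trans[OF _ asm(5,3)] by blast
    show ?thesis
      by (rule essential_splitI[of e]) (use e(1-4) ek' mt ess in auto)
  qed
  from this[of k k'] this[of k' k] show ?thesis using assms by blast
qed

lemma extending_iff:
  "extending A M \<longleftrightarrow> (\<forall>k. is_mono A k \<and> Cod A k = M \<longrightarrow> essential_split A M k)"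
  unfolding extending_def using essential_in_summand_iff by auto

lemma self_CS_Rickart_iff:
  "self_CS_Rickart A M \<longleftrightarrow> (\<forall>f\<in>Hom A M M. essential_split A M (Ker A f))"
  unfolding self_CS_Rickart_def using essential_in_summand_iff by (auto simp: Hom_iff)

lemma SIP_extending_iff:
  "SIP_extending A M \<longleftrightarrow> (\<forall>k l. is_mono A k \<and> Cod A k = M \<and> is_mono A l \<and> Cod A l = M \<and>
     essential_split A M k \<and> essential_split A M l \<longrightarrow> essential_split A M (k \<sqinter>\<^bsub>Sub A M\<^esub> l))"
proof -
  have "essential_in_summand A M (k \<sqinter>\<^bsub>Sub A M\<^esub> l) \<longleftrightarrow> essential_split A M (k \<sqinter>\<^bsub>Sub A M\<^esub> l)"
    if "is_mono A k" "Cod A k = M" "is_mono A l" "Cod A l = M" for k l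
    using meet_props(1,2)[OF that] by (rule essential_in_summand_iff)
  thus ?thesis unfolding SIP_extending_def by (auto simp: essential_in_summand_iff)
qed

lemma Coker_Ker_epi:
  assumes "is_epi A c"
  shows "factors_through (dual A) c (Coker A (Ker A c))" "factors_through (dual A) (Coker A (Ker A c)) c"
  using op.Ker_Coker_mono[of c] assms by simp_all

lemma essential_split_dual_cong:
  assumes "is_epi A c" "is_epi A c'" "Dom A c = M" "Dom A c' = M"
    "factors_through (dual A) c c'" "factors_through (dual A) c' c"
  shows "essential_split (dual A) M c \<longleftrightarrow> essential_split (dual A) M c'"
  by (rule abelian_category.essential_split_cong[OF abelian_category_op]) (use assms epi_Mor in auto)

lemma essential_split_Coker_Ker_iff:
  assumes "is_epi A c" "Dom A c = M"
  shows "essential_split (dual A) M (Coker A (Ker A c)) \<longleftrightarrow> essential_split (dual A) M c"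
  by (rule essential_split_dual_cong) (use assms epi_Mor[OF assms(1)] Coker_Ker_epi in auto)

lemma lifting_iff:
  "lifting A M \<longleftrightarrow> (\<forall>c. is_epi A c \<and> Dom A c = M \<longrightarrow> essential_split (dual A) M c)"
proof
  assume L: "lifting A M"
  show "\<forall>c. is_epi A c \<and> Dom A c = M \<longrightarrow> essential_split (dual A) M c"
  proof (intro allI impI; elim conjE)
    fix c assume c: "is_epi A c" "Dom A c = M"
    hence K: "is_mono A (Ker A c)" "Cod A (Ker A c) = M" using epi_Mor[OF c(1)] by auto
    hence "lies_above_summand A M (Ker A c)" using L by (simp add: lifting_def)
    thus "essential_split (dual A) M c"
      using lies_above_summand_iff[OF K] essential_split_Coker_Ker_iff[OF c] by simp
  qed
next
  assume R: "\<forall>c. is_epi A c \<and> Dom A c = M \<longrightarrow> essential_split (dual A) M c"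
  show "lifting A M"
    unfolding lifting_def
  proof
    fix l assume "l \<in> carrier (Sub A M)"
    hence l: "is_mono A l" "Cod A l = M" by auto
    show "lies_above_summand A M l"
      unfolding lies_above_summand_iff[OF l] using R l mono_Mor[OF l(1)] by simp
  qed
qed

lemma dual_self_CS_Rickart_iff:
  "dual_self_CS_Rickart A M \<longleftrightarrow> (\<forall>f\<in>Hom A M M. essential_split (dual A) M (Coker A f))"
proof -
  have "lies_above_summand A M (Img A f) \<longleftrightarrow> essential_split (dual A) M (Coker A f)"
    if "f \<in> Hom A M M" for f
  proof -
    have f: "f \<in> Mor A" "Cod A f = M" using that by (auto simp: Hom_iff)
    show ?thesis
      unfolding Img_def using lies_above_summand_iff[of "Ker A (Coker A f)" M]
        essential_split_Coker_Ker_iff[of "Coker A f" M] f by simp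
  qed
  thus ?thesis unfolding dual_self_CS_Rickart_def by simp
qed

text \<open>A quotient of \<open>M\<close> lies below both \<open>Coker k\<close> and \<open>Coker l\<close> iff it kills \<open>k\<close> and \<open>l\<close>, that is, iff
  it kills their sum. Here \<open>c\<close> and \<open>d\<close> stand for \<open>Coker k\<close> and \<open>Coker l\<close> up to isomorphism, so that
  one can start from quotients as well as from subobjects.\<close>

lemma Coker_join:
  assumes k: "is_mono A k" "Cod A k = M" and l: "is_mono A l" "Cod A l = M"
    and c: "is_epi A c" "Dom A c = M" "factors_through (dual A) c (Coker A k)"
      "factors_through (dual A) (Coker A k) c"
    and d: "is_epi A d" "Dom A d = M" "factors_through (dual A) d (Coker A l)"
      "factors_through (dual A) (Coker A l) d"
  shows "essential_split (dual A) M (Coker A (k \<squnion>\<^bsub>Sub A M\<^esub> l)) \<longleftrightarrow>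
    essential_split (dual A) M (c \<sqinter>\<^bsub>Sub (dual A) M\<^esub> d)"
proof -
  define n where "n = c \<sqinter>\<^bsub>Sub (dual A) M\<^esub> d"
  define u where "u = k \<squnion>\<^bsub>Sub A M\<^esub> l"
  have mor: "k \<in> Mor A" "l \<in> Mor A" "c \<in> Mor A" "d \<in> Mor A"
    using k l c d by (auto intro: mono_Mor epi_Mor)
  have n: "is_epi A n" "Dom A n = M" "factors_through (dual A) n c" "factors_through (dual A) n d"
    and n_max: "\<And>x. \<lbrakk>x \<in> Mor A; factors_through (dual A) x c; factors_through (dual A) x d\<rbrakk>
      \<Longrightarrow> factors_through (dual A) x n"
    using op.meet_props[of c M d, folded n_def] c d by simp_all
  note u = join_props[OF k l, folded u_def]
  have um: "u \<in> Mor A" and nm: "n \<in> Mor A" using u(1) n(1) by (auto intro: mono_Mor epi_Mor)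
  note trans = op.factors_through_trans[unfolded dual_simps]
  have "factors_through (dual A) n (Coker A k)" "factors_through (dual A) n (Coker A l)"
    using trans[OF n(3) c(3)] trans[OF n(4) d(3)] mor by simp_all
  hence "n \<cdot> u = zero (Dom A u) (Cod A n)"
    using factors_through_Coker_iff[of k n] factors_through_Coker_iff[of l n] nm n(2) mor k l
    by (intro u(5)) auto
  hence 1: "factors_through (dual A) n (Coker A u)"
    using factors_through_Coker_iff[of u n] nm um n(2) u(2) by simp
  have "Coker A u \<cdot> k = zero (Dom A k) (Cod A (Coker A u))"
    "Coker A u \<cdot> l = zero (Dom A l) (Cod A (Coker A u))"
    using factors_through_mono_iff[OF u(1)] u mor k l by auto
  hence "factors_through (dual A) (Coker A u) (Coker A k)"
    "factors_through (dual A) (Coker A u) (Coker A l)"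
    using factors_through_Coker_iff[of k "Coker A u"] factors_through_Coker_iff[of l "Coker A u"]
      um u(2) mor k l by auto
  hence 2: "factors_through (dual A) (Coker A u) n"
    using trans[OF _ c(4)] trans[OF _ d(4)] mor um by (intro n_max) auto
  show ?thesis
    unfolding n_def[symmetric] u_def[symmetric]
    by (rule essential_split_dual_cong) (use n um u(2) 1 2 in auto)
qed

lemma SSP_lifting_iff:
  "SSP_lifting A M \<longleftrightarrow> (\<forall>c d. is_epi A c \<and> Dom A c = M \<and> is_epi A d \<and> Dom A d = M \<and>
     essential_split (dual A) M c \<and> essential_split (dual A) M d
     \<longrightarrow> essential_split (dual A) M (c \<sqinter>\<^bsub>Sub (dual A) M\<^esub> d))"
proof -
  have join: "lies_above_summand A M (k \<squnion>\<^bsub>Sub A M\<^esub> l) \<longleftrightarrow>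
      essential_split (dual A) M (Coker A (k \<squnion>\<^bsub>Sub A M\<^esub> l))"
    if "is_mono A k" "Cod A k = M" "is_mono A l" "Cod A l = M" for k l
    using join_props(1,2)[OF that] by (rule lies_above_summand_iff)
  show ?thesis
  proof (intro iffI allI impI; (elim conjE)?)
    fix c d assume S: "SSP_lifting A M" and c: "is_epi A c" "Dom A c = M"
      and d: "is_epi A d" "Dom A d = M"
      and ess: "essential_split (dual A) M c" "essential_split (dual A) M d"
    have k: "is_mono A (Ker A c)" "Cod A (Ker A c) = M" and l: "is_mono A (Ker A d)" "Cod A (Ker A d) = M"
      using epi_Mor[OF c(1)] epi_Mor[OF d(1)] c d by auto
    have "lies_above_summand A M (Ker A c)" "lies_above_summand A M (Ker A d)"
      using ess lies_above_summand_iff[OF k] lies_above_summand_iff[OF l]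
        essential_split_Coker_Ker_iff[OF c] essential_split_Coker_Ker_iff[OF d] by auto
    hence "lies_above_summand A M (Ker A c \<squnion>\<^bsub>Sub A M\<^esub> Ker A d)"
      using S k l by (simp add: SSP_lifting_def)
    thus "essential_split (dual A) M (c \<sqinter>\<^bsub>Sub (dual A) M\<^esub> d)"
      using join[OF k l] Coker_join[OF k l c Coker_Ker_epi[OF c(1)] d Coker_Ker_epi[OF d(1)]] by simp
  next
    assume R: "\<forall>c d. is_epi A c \<and> Dom A c = M \<and> is_epi A d \<and> Dom A d = M \<and>
     essential_split (dual A) M c \<and> essential_split (dual A) M d
     \<longrightarrow> essential_split (dual A) M (c \<sqinter>\<^bsub>Sub (dual A) M\<^esub> d)"
    show "SSP_lifting A M"
      unfolding SSP_lifting_def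
    proof (intro ballI impI; elim conjE)
      fix k l assume "k \<in> carrier (Sub A M)" "l \<in> carrier (Sub A M)"
        and ess: "lies_above_summand A M k" "lies_above_summand A M l"
      hence k: "is_mono A k" "Cod A k = M" and l: "is_mono A l" "Cod A l = M" by auto
      have c: "is_epi A (Coker A k)" "Dom A (Coker A k) = M" and d: "is_epi A (Coker A l)" "Dom A (Coker A l) = M"
        using mono_Mor[OF k(1)] mono_Mor[OF l(1)] k l by auto
      have refl: "is_epi A c \<Longrightarrow> factors_through (dual A) c c" for c
        using op.factors_through_refl[of c] epi_Mor[of c] by simp
      have "essential_split (dual A) M (Coker A k \<sqinter>\<^bsub>Sub (dual A) M\<^esub> Coker A l)"
        using R ess c d lies_above_summand_iff[OF k] lies_above_summand_iff[OF l] by blast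
      thus "lies_above_summand A M (k \<squnion>\<^bsub>Sub A M\<^esub> l)"
        using join[OF k l] Coker_join[OF k l c refl[OF c(1)] refl[OF c(1)] d refl[OF d(1)] refl[OF d(1)]]
        by simp
    qed
  qed
qed

text \<open>Part (1) of the theorem, in the form in which it can be read in the opposite category. As only
  some direct sum of \<open>M\<close> and \<open>E\<close> lies in the class, the two preceding constructions have to work
  with any direct sum.\<close>

lemma essential_split_equivalences:
  assumes inj: "enough_injectives A" "\<forall>E. injective_object A E \<longrightarrow> E \<in> \<C>"
    and C: "\<C> \<subseteq> Obj A" "closed_under_direct_sums A \<C>"
  shows "(\<forall>M\<in>\<C>. \<forall>k. is_mono A k \<and> Cod A k = M \<longrightarrow> essential_split A M k) \<longleftrightarrow>
      (\<forall>M\<in>\<C>. \<forall>f\<in>Hom A M M. essential_split A M (Ker A f))" (is "?all \<longleftrightarrow> ?kernels")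
    and "(\<forall>M\<in>\<C>. \<forall>f\<in>Hom A M M. essential_split A M (Ker A f)) \<longleftrightarrow>
      (\<forall>M\<in>\<C>. \<forall>k l. is_mono A k \<and> Cod A k = M \<and> is_mono A l \<and> Cod A l = M \<and>
         essential_split A M k \<and> essential_split A M l \<longrightarrow> essential_split A M (k \<sqinter>\<^bsub>Sub A M\<^esub> l))"
      (is "_ \<longleftrightarrow> ?meets")
proof -
  have 1: "?kernels" if ?all
    using that by (auto simp: Hom_iff)
  have 2: "?meets" if ?all
    using that meet_props(1,2) by blast
  have 3: "?all" if "?kernels \<or> ?meets"
  proof (intro ballI allI impI; elim conjE)
    fix M k assume M: "M \<in> \<C>" and k: "is_mono A k" "Cod A k = M"
    obtain f where f: "f \<in> Mor A" "Dom A f = M" "injective_object A (Cod A f)"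
      "f \<cdot> k = zero (Dom A k) (Cod A f)"
      and kf: "\<And>g. \<lbrakk>g \<in> Mor A; Cod A g = M; f \<cdot> g = zero (Dom A g) (Cod A f)\<rbrakk>
        \<Longrightarrow> factors_through A g k"
      using mono_is_kernel_to_injective[OF inj(1) k(1)] k(2) by blast
    obtain S i j p q where S: "S \<in> \<C>" and sum: "is_direct_sum A M (Cod A f) S i j p q"
      using direct_sum_in_class[OF C(2) M] inj(2) f(3) by blast
    note s = direct_sumD[OF sum] and c = direct_sum_cmp[OF sum]
    from that show "essential_split A M k"
    proof
      assume ?kernels
      moreover have "j \<cdot> (f \<cdot> p) \<in> Hom A S S" using s f by (simp add: Hom_iff)
      ultimately have ess: "essential_split A S (Ker A (j \<cdot> (f \<cdot> p)))" using S by blast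
      show ?thesis
        by (rule essential_split_if_kernel[OF f(1,2) refl k f(4) _ sum ess]) (rule kf)
    next
      assume meets: ?meets
      have g: "i +\<^bsub>A\<^esub> j \<cdot> f \<in> Mor A" "Dom A (i +\<^bsub>A\<^esub> j \<cdot> f) = M" "Cod A (i +\<^bsub>A\<^esub> j \<cdot> f) = S"
        using s f by simp_all
      have pg: "p \<cdot> (i +\<^bsub>A\<^esub> j \<cdot> f) = Ide A M" using c(3)[of f] s f by simp
      have "is_mono A i" by (rule split_mono[of p]) (use s in auto)
      moreover have "is_mono A (i +\<^bsub>A\<^esub> j \<cdot> f)" by (rule split_mono[of p]) (use s g pg in auto)
      moreover have "essential_split A S i"
        by (rule split_mono_essential_split[of _ p]) (use s in auto)
      moreover have "essential_split A S (i +\<^bsub>A\<^esub> j \<cdot> f)"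
        by (rule split_mono_essential_split[of _ p]) (use s g pg in auto)
      ultimately have ess: "essential_split A S (i \<sqinter>\<^bsub>Sub A S\<^esub> (i +\<^bsub>A\<^esub> j \<cdot> f))"
        using meets S s(3) g(3) by blast
      show ?thesis
        by (rule essential_split_if_meet[OF f(1,2) refl k f(4) _ f(3) sum ess]) (rule kf)
    qed
  qed
  show "?all \<longleftrightarrow> ?kernels" using 1 3 by blast
  show "?kernels \<longleftrightarrow> ?meets" using 1 2 3 by blast
qed

end

theorem theorem5p1:
  fixes A :: "('o, 'm) cat_struct"
  assumes "abelian_category A"
  shows "(enough_injectives A \<longrightarrow>
      (\<forall>\<C> \<subseteq> Obj A.
         closed_under_direct_sums A \<C> \<and> (\<forall>E. injective_object A E \<longrightarrow> E \<in> \<C>) \<longrightarrow>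
         ((\<forall>M\<in>\<C>. extending A M) \<longleftrightarrow> (\<forall>M\<in>\<C>. self_CS_Rickart A M)) \<and>
         ((\<forall>M\<in>\<C>. self_CS_Rickart A M) \<longleftrightarrow> (\<forall>M\<in>\<C>. SIP_extending A M))))
    \<and> (enough_projectives A \<longrightarrow>
      (\<forall>\<C> \<subseteq> Obj A.
         closed_under_direct_sums A \<C> \<and> (\<forall>P. projective_object A P \<longrightarrow> P \<in> \<C>) \<longrightarrow>
         ((\<forall>M\<in>\<C>. lifting A M) \<longleftrightarrow> (\<forall>M\<in>\<C>. dual_self_CS_Rickart A M)) \<and>
         ((\<forall>M\<in>\<C>. dual_self_CS_Rickart A M) \<longleftrightarrow> (\<forall>M\<in>\<C>. SSP_lifting A M))))"
proof -
  interpret abelian_category A by fact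
  interpret op: abelian_category "dual A" by (rule abelian_category_op)
  show ?thesis
  proof (intro conjI impI allI; elim conjE)
    fix \<C> assume "enough_injectives A" "\<C> \<subseteq> Obj A" "closed_under_direct_sums A \<C>"
      "\<forall>E. injective_object A E \<longrightarrow> E \<in> \<C>"
    note eq = essential_split_equivalences[OF this(1,4,2,3)]
    show "(\<forall>M\<in>\<C>. extending A M) \<longleftrightarrow> (\<forall>M\<in>\<C>. self_CS_Rickart A M)"
      unfolding extending_iff self_CS_Rickart_iff by (rule eq(1))
    show "(\<forall>M\<in>\<C>. self_CS_Rickart A M) \<longleftrightarrow> (\<forall>M\<in>\<C>. SIP_extending A M)"
      unfolding self_CS_Rickart_iff SIP_extending_iff by (rule eq(2))
  next
    fix \<C> assume "enough_projectives A" "\<C> \<subseteq> Obj A" "closed_under_direct_sums A \<C>"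
      "\<forall>P. projective_object A P \<longrightarrow> P \<in> \<C>"
    hence "enough_injectives (dual A)" "\<forall>E. injective_object (dual A) E \<longrightarrow> E \<in> \<C>"
      "\<C> \<subseteq> Obj (dual A)" "closed_under_direct_sums (dual A) \<C>" by simp_all
    note eq = op.essential_split_equivalences[OF this, unfolded dual_simps Hom_dual is_mono_dual Ker_dual]
    show "(\<forall>M\<in>\<C>. lifting A M) \<longleftrightarrow> (\<forall>M\<in>\<C>. dual_self_CS_Rickart A M)"
      unfolding lifting_iff dual_self_CS_Rickart_iff by (rule eq(1))
    show "(\<forall>M\<in>\<C>. dual_self_CS_Rickart A M) \<longleftrightarrow> (\<forall>M\<in>\<C>. SSP_lifting A M)"
      unfolding dual_self_CS_Rickart_iff SSP_lifting_iff by (rule eq(2))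
  qed
qed

end
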